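(* Given a three point set $Y$ in $\mathbb{CH}^n$, let $X=\{x_1,x_2,x_3\}$ be the normal form of $Y$ and $H=DA_2(X)$. The following are equivalent: (1) The points of $Y$ lie in a single complex geodesic. (2) $X\in\mathcal E$. (3) $LF_{123}^2=\delta_{13}^2$. (4) $M_2=\alpha M_3$ for some $\alpha\in\mathbb{C}$ with $|\alpha|=1$. (5) $m_{23}=m_2m_3$. (6) $\|m_2m_3\|=1$. (7) $\Delta=\delta_{12}\delta_{13}$.
   Context: $\mathbb{B}^n\subset\mathbb{C}^n$ is the open unit ball, the model of $\mathbb{CH}^n$; $\operatorname{Aut}(\mathbb{B}^n)$ is its group of biholomorphic automorphisms. A complex geodesic is an image under $\operatorname{Aut}(\mathbb{B}^n)$ of $\{(z,0,\dots,0):|z|<1\}$. Every ordered three point set $Y\subset\mathbb{B}^n$ is congruent, via an automorphism respecting order, to a unique set $X=\{x_1,x_2,x_3\}$ with $x_1=(0,0)$, $x_2=(s,0)$, $x_3=(w,t)$, $s>0$, $w\in\mathbb{C}$, $t\ge0$ (remaining coordinates zero, so $X\subset\mathbb{B}^2$; for $n=1$ include $\mathbb{B}^1$ in $\mathbb{B}^2$ as the points with second coordinate zero); $X$ is the normal form of $Y$. $\mathcal E$ is the class of such $X$ with $t=0$. $DA_2$ is the Hilbert space of holomorphic functions on $\mathbb{B}^2$ with kernels $k_z(w)=(1-\langle w,z\rangle)^{-1}$; $DA_2(X)$ is the span of $\{k_x\}_{x\in X}$, viewed as functions on $X$. Put $k_{ij}=\langle k_{x_i},k_{x_j}\rangle$,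 $\delta_{ij}=\left(1-\frac{|k_{ij}|^2}{k_{ii}k_{jj}}\right)^{1/2}$, $LF_{123}^2=\frac1{\delta_{12}^2}\left|1-\frac{k_{21}k_{13}}{k_{23}k_{11}}\right|^2$. $\operatorname{Mult}(H)$ is the algebra of functions $m$ on $X$ with norm $\|m\|$ equal to the operator norm of $h\mapsto mh$ on $H$. For $i=2,3$: $M_i$ is the (unique) multiplier of norm one with $M_i(x_1)=0$ maximizing $\operatorname{Re}M(x_i)$; $m_i$ is the (unique) multiplier of norm one with $m_i(x_i)=0$ maximizing $\operatorname{Re}m(x_1)$; $m_{23}$ is the (unique) multiplier of norm one vanishing at $x_2$ and $x_3$ and maximizing $\operatorname{Re}m(x_1)$. $\Delta=\sup\{\operatorname{Re}m(x_1):m\in\operatorname{Mult}(H),\ m(x_2)=m(x_3)=0,\ \|m\|\le1\}$. *)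

theory Defs
  imports "HOL-Analysis.Analysis"
begin

definition tfae :: "bool list \<Rightarrow> bool" where
  "tfae Ps \<longleftrightarrow> (\<forall>P\<in>set Ps. \<forall>Q\<in>set Ps. P \<longleftrightarrow> Q)"

abbreviation unit_ball :: "(complex ^ 'n) set" where
  "unit_ball \<equiv> ball 0 1"

definition hinner :: "complex ^ 'n \<Rightarrow> complex ^ 'n \<Rightarrow> complex" where
  "hinner w z = (\<Sum>i\<in>UNIV. w $ i * cnj (z $ i))"


subsection \<open>Automorphisms of the ball and complex geodesics\<close>

definition holo_fun :: "(complex ^ 'n \<Rightarrow> complex) \<Rightarrow> (complex ^ 'n) set \<Rightarrow> bool" where
  "holo_fun f S \<longleftrightarrow>
     (\<forall>z\<in>S. \<exists>D. (f has_derivative D) (at z) \<and> (\<forall>c v. D (c *s v) = c * D v))"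

definition holo_map :: "(complex ^ 'n \<Rightarrow> complex ^ 'm) \<Rightarrow> (complex ^ 'n) set \<Rightarrow> bool" where
  "holo_map f S \<longleftrightarrow> (\<forall>i. holo_fun (\<lambda>z. f z $ i) S)"

definition ball_aut :: "(complex ^ 'n \<Rightarrow> complex ^ 'n) set" where
  "ball_aut = {f. bij_betw f unit_ball unit_ball \<and> holo_map f unit_ball \<and>
                  holo_map (inv_into unit_ball f) unit_ball}"

text \<open>The index type carries no order, so the coordinates are ordered by an enumeration
  \<open>e\<close>, a bijection from \<open>{1..CARD('n)}\<close> to the index type: the \<open>k\<close>-th coordinate
  of \<open>z\<close> is \<open>z $ e k\<close>. Coordinates beyond the dimension are read as zero; this gives the
  inclusion of the one-dimensional ball into the two-dimensional one.\<close>

definition coord :: "(nat \<Rightarrow> 'n) \<Rightarrow> complex ^ 'n \<Rightarrow> nat \<Rightarrow> complex" where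
  "coord e z k = (if k \<in> {1..CARD('n)} then z $ e k else 0)"

definition complex_geodesic :: "(nat \<Rightarrow> 'n) \<Rightarrow> (complex ^ 'n) set \<Rightarrow> bool" where
  "complex_geodesic e G \<longleftrightarrow>
     (\<exists>f\<in>ball_aut. G = f ` {z \<in> unit_ball. \<forall>k\<ge>2. coord e z k = 0})"


subsection \<open>Normal forms of ordered triples\<close>

text \<open>An ordered three point set is a function on \<open>{1,2,3}\<close>; its values elsewhere are
  irrelevant.\<close>

definition normal_triple :: "real \<Rightarrow> complex \<Rightarrow> real \<Rightarrow> (nat \<Rightarrow> complex ^ 2) \<Rightarrow> bool" where
  "normal_triple s w t x \<longleftrightarrow>
     s > 0 \<and> t \<ge> 0 \<and>
     x 1 = vector [0, 0] \<and> x 2 = vector [of_real s, 0] \<and> x 3 = vector [w, of_real t] \<and>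
     inj_on x {1, 2, 3} \<and> x ` {1, 2, 3} \<subseteq> unit_ball"

definition normal_form ::
  "(nat \<Rightarrow> 'n) \<Rightarrow> (nat \<Rightarrow> complex ^ 'n) \<Rightarrow> (nat \<Rightarrow> complex ^ 2) \<Rightarrow> bool" where
  "normal_form e y x \<longleftrightarrow>
     (\<exists>s w t. normal_triple s w t x) \<and>
     (\<exists>f\<in>ball_aut. \<forall>i\<in>{1, 2, 3}.
        coord e (f (y i)) 1 = x i $ 1 \<and> coord e (f (y i)) 2 = x i $ 2 \<and>
        (\<forall>k>2. coord e (f (y i)) k = 0))"

definition class_E :: "(nat \<Rightarrow> complex ^ 2) set" where
  "class_E = {x. \<exists>s w. normal_triple s w 0 x}"


subsection \<open>The Drury--Arveson space\<close>

text \<open>A function on a set \<open>B\<close> is a total function that vanishes off \<open>B\<close>, so that equality of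
  functions on \<open>B\<close> is equality. The inner product is linear in its first argument.\<close>

definition functions_on :: "'a set \<Rightarrow> ('a \<Rightarrow> complex) set" where
  "functions_on B = {f. \<forall>z. z \<notin> B \<longrightarrow> f z = 0}"

type_synonym 'a ip = "('a \<Rightarrow> complex) \<Rightarrow> ('a \<Rightarrow> complex) \<Rightarrow> complex"

definition ip_norm :: "'a ip \<Rightarrow> ('a \<Rightarrow> complex) \<Rightarrow> real" where
  "ip_norm ip f = sqrt (Re (ip f f))"

definition hilbert_function_space :: "'a set \<Rightarrow> ('a \<Rightarrow> complex) set \<Rightarrow> 'a ip \<Rightarrow> bool" where
  "hilbert_function_space B H ip \<longleftrightarrow>
     H \<subseteq> functions_on B \<and>
     (\<lambda>z. 0) \<in> H \<and>
     (\<forall>f\<in>H. \<forall>g\<in>H. (\<lambda>z. f z + g z) \<in> H) \<and>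
     (\<forall>c. \<forall>f\<in>H. (\<lambda>z. c * f z) \<in> H) \<and>
     (\<forall>f\<in>H. \<forall>g\<in>H. \<forall>h\<in>H. ip (\<lambda>z. f z + g z) h = ip f h + ip g h) \<and>
     (\<forall>c. \<forall>f\<in>H. \<forall>h\<in>H. ip (\<lambda>z. c * f z) h = c * ip f h) \<and>
     (\<forall>f\<in>H. \<forall>g\<in>H. ip g f = cnj (ip f g)) \<and>
     (\<forall>f\<in>H. 0 \<le> Re (ip f f)) \<and>
     (\<forall>f\<in>H. ip f f = 0 \<longrightarrow> f = (\<lambda>z. 0)) \<and>
     (\<forall>u. (\<forall>n. u n \<in> H) \<and>
          (\<forall>\<epsilon>>0. \<exists>N. \<forall>m\<ge>N. \<forall>n\<ge>N. ip_norm ip (\<lambda>z. u m z - u n z) < \<epsilon>) \<longrightarrow>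
          (\<exists>f\<in>H. (\<lambda>n. ip_norm ip (\<lambda>z. u n z - f z)) \<longlonglongrightarrow> 0))"

definition da_kernel :: "complex ^ 2 \<Rightarrow> complex ^ 2 \<Rightarrow> complex" where
  "da_kernel z w = (if w \<in> unit_ball then inverse (1 - hinner w z) else 0)"

text \<open>A Hilbert space of functions is determined by its reproducing kernel, so at most one
  \<open>H\<close>, with one inner product on \<open>H\<close>, satisfies the following.\<close>

definition drury_arveson_2 :: "(complex ^ 2 \<Rightarrow> complex) set \<Rightarrow> (complex ^ 2) ip \<Rightarrow> bool" where
  "drury_arveson_2 H ip \<longleftrightarrow>
     hilbert_function_space unit_ball H ip \<and>
     (\<forall>f\<in>H. holo_fun f unit_ball) \<and>
     (\<forall>z\<in>unit_ball. da_kernel z \<in> H \<and> (\<forall>f\<in>H. f z = ip f (da_kernel z)))"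

definition kernel_span :: "(complex ^ 2) set \<Rightarrow> (complex ^ 2 \<Rightarrow> complex) set" where
  "kernel_span X = {F. \<exists>c. F = (\<lambda>z. \<Sum>p\<in>X. c p * da_kernel p z)}"

definition restr :: "'a set \<Rightarrow> ('a \<Rightarrow> complex) \<Rightarrow> 'a \<Rightarrow> complex" where
  "restr X F = (\<lambda>z. if z \<in> X then F z else 0)"

definition DA2X :: "(complex ^ 2) set \<Rightarrow> (complex ^ 2 \<Rightarrow> complex) set" where
  "DA2X X = restr X ` kernel_span X"

text \<open>An element of the span is orthogonal to it if it vanishes on \<open>X\<close>. Hence restriction to
  \<open>X\<close> is injective on the span, and the norm of the span carries over to functions on \<open>X\<close>.\<close>

definition DA2X_norm :: "(complex ^ 2) ip \<Rightarrow> (complex ^ 2) set \<Rightarrow> (complex ^ 2 \<Rightarrow> complex) \<Rightarrow> real" where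
  "DA2X_norm ip X h = ip_norm ip (THE F. F \<in> kernel_span X \<and> restr X F = h)"


subsection \<open>Multipliers\<close>

definition Mult :: "(complex ^ 2) set \<Rightarrow> (complex ^ 2 \<Rightarrow> complex) set" where
  "Mult X = {m \<in> functions_on X. \<forall>h\<in>DA2X X. (\<lambda>z. m z * h z) \<in> DA2X X}"

definition mult_norm :: "(complex ^ 2) ip \<Rightarrow> (complex ^ 2) set \<Rightarrow> (complex ^ 2 \<Rightarrow> complex) \<Rightarrow> real" where
  "mult_norm ip X m = Sup {DA2X_norm ip X (\<lambda>z. m z * h z) | h. h \<in> DA2X X \<and> DA2X_norm ip X h \<le> 1}"

definition extremal_mult ::
  "(complex ^ 2) ip \<Rightarrow> (complex ^ 2) set \<Rightarrow> (complex ^ 2) set \<Rightarrow> complex ^ 2 \<Rightarrow> complex ^ 2 \<Rightarrow> complex" where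
  "extremal_mult ip X Z p =
     (let A = {m \<in> Mult X. mult_norm ip X m = 1 \<and> (\<forall>z\<in>Z. m z = 0)}
      in THE m. m \<in> A \<and> (\<forall>m'\<in>A. Re (m' p) \<le> Re (m p)))"

abbreviation points :: "(nat \<Rightarrow> 'a) \<Rightarrow> 'a set" where
  "points x \<equiv> x ` {1, 2, 3}"

definition M_at :: "(complex ^ 2) ip \<Rightarrow> (nat \<Rightarrow> complex ^ 2) \<Rightarrow> nat \<Rightarrow> complex ^ 2 \<Rightarrow> complex" where
  "M_at ip x i = extremal_mult ip (points x) {x 1} (x i)"

definition m_at :: "(complex ^ 2) ip \<Rightarrow> (nat \<Rightarrow> complex ^ 2) \<Rightarrow> nat \<Rightarrow> complex ^ 2 \<Rightarrow> complex" where
  "m_at ip x i = extremal_mult ip (points x) {x i} (x 1)"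

definition m23 :: "(complex ^ 2) ip \<Rightarrow> (nat \<Rightarrow> complex ^ 2) \<Rightarrow> complex ^ 2 \<Rightarrow> complex" where
  "m23 ip x = extremal_mult ip (points x) {x 2, x 3} (x 1)"

definition Delta :: "(complex ^ 2) ip \<Rightarrow> (nat \<Rightarrow> complex ^ 2) \<Rightarrow> real" where
  "Delta ip x = Sup {Re (m (x 1)) | m.
     m \<in> Mult (points x) \<and> m (x 2) = 0 \<and> m (x 3) = 0 \<and> mult_norm ip (points x) m \<le> 1}"


subsection \<open>Invariants of a triple\<close>

definition kk :: "(complex ^ 2) ip \<Rightarrow> (nat \<Rightarrow> complex ^ 2) \<Rightarrow> nat \<Rightarrow> nat \<Rightarrow> complex" where
  "kk ip x i j = ip (da_kernel (x i)) (da_kernel (x j))"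

definition delta :: "(complex ^ 2) ip \<Rightarrow> (nat \<Rightarrow> complex ^ 2) \<Rightarrow> nat \<Rightarrow> nat \<Rightarrow> real" where
  "delta ip x i j =
     sqrt (1 - (cmod (kk ip x i j))\<^sup>2 / (Re (kk ip x i i) * Re (kk ip x j j)))"

definition LF_sq :: "(complex ^ 2) ip \<Rightarrow> (nat \<Rightarrow> complex ^ 2) \<Rightarrow> real" where
  "LF_sq ip x =
     1 / (delta ip x 1 2)\<^sup>2 *
     (cmod (1 - (kk ip x 2 1 * kk ip x 1 3) / (kk ip x 2 3 * kk ip x 1 1)))\<^sup>2"

end

(* Each of (2)-(7) is equivalent to equality |<x3, x2>|^2 = |x2|^2 |x3|^2 in the Cauchy-Schwarz
   inequality, which for a normal form means t = 0.

   A multiplier is contractive iff its adjoint, which is diagonal in the kernel functions, decreases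
   the Gram form. In the normal form all kernels k_{1j} are 1, and completing the square in one or two
   of the three coefficients reduces this to binary Hermitian forms. An extremal multiplier makes one
   diagonal entry of the binary form vanish, so its off-diagonal entry vanishes too; this determines
   the extremal multiplier and gives its uniqueness. The product m_2 m_3 and m_23 both live at the
   single point x1, where they have the values delta_12 delta_13 and the square root of a Schur
   complement of the Gram matrix.

   For (1) no classification of automorphisms is needed. If h is a disc of the ball through 0 with a
   holomorphic left inverse, the Schwarz lemma applied to h and to the left inverse gives
   |h(z)| <= |z|, with equality at the preimage of x2, so the first coordinate of h is a rotation and
   the other coordinates vanish. *)
theory Submission
  imports Defs "HOL-Complex_Analysis.Riemann_Mapping"
begin

unbundle no fps_syntax

section \<open>Complex geodesics through the origin\<close>

lemma hinner_self: "hinner z z = of_real ((norm z)\<^sup>2)"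
proof -
  have "(norm z)\<^sup>2 = (\<Sum>i\<in>UNIV. (norm (z $ i))\<^sup>2)"
    by (simp add: norm_vec_def L2_set_def sum_nonneg)
  then show ?thesis
    by (simp only: hinner_def of_real_sum complex_norm_square)
qed

lemma cmod_hinner_le: "cmod (hinner w z) \<le> norm w * norm z"
proof -
  have "cmod (hinner w z) \<le> (\<Sum>i\<in>UNIV. cmod (w $ i * cnj (z $ i)))"
    unfolding hinner_def by (rule norm_sum)
  also have "\<dots> = (\<Sum>i\<in>UNIV. \<bar>cmod (w $ i)\<bar> * \<bar>cmod (z $ i)\<bar>)"
    by (simp add: norm_mult)
  also have "\<dots> \<le> norm w * norm z"
    unfolding norm_vec_def by (rule L2_set_mult_ineq)
  finally show ?thesis .
qed

lemma norm_scale: "norm (c *s (v :: complex ^ 'n)) = cmod c * norm v"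
  by (simp add: norm_vec_def norm_mult L2_set_right_distrib)

text \<open>Chain rule for real derivatives: complex linearity of \<open>D\<close> turns
  \<open>D (c *s v)\<close> into \<open>c * D v\<close>, which is a complex derivative. This makes
  one-variable function theory available for maps of the ball.\<close>

lemma holo_fun_compose_curve:
  fixes \<gamma> :: "complex \<Rightarrow> complex ^ 'n"
  assumes f: "holo_fun f S" and T: "open T" and \<gamma>: "\<And>i. (\<lambda>\<zeta>. \<gamma> \<zeta> $ i) holomorphic_on T"
    and sub: "\<gamma> ` T \<subseteq> S"
  shows "(\<lambda>\<zeta>. f (\<gamma> \<zeta>)) holomorphic_on T"
proof -
  have "\<exists>d. ((\<lambda>\<zeta>. f (\<gamma> \<zeta>)) has_field_derivative d) (at \<zeta>)" if "\<zeta> \<in> T" for \<zeta>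
  proof -
    define v where "v = (\<chi> i. deriv (\<lambda>\<zeta>. \<gamma> \<zeta> $ i) \<zeta>)"
    have "((\<lambda>\<zeta>. \<gamma> \<zeta> $ i) has_field_derivative v $ i) (at \<zeta>)" for i
      using holomorphic_derivI[OF \<gamma> T that] by (simp add: v_def)
    then have "((\<lambda>\<zeta>. \<gamma> \<zeta> $ i) has_derivative (\<lambda>c. c * v $ i)) (at \<zeta>)" for i
      by (simp add: has_field_derivative_def mult_commute_abs)
    then have "((\<lambda>\<zeta>. \<gamma> \<zeta> $ i \<bullet> b) has_derivative (\<lambda>c. (c * v $ i) \<bullet> b)) (at \<zeta>)" for i b
      by (rule has_derivative_inner_left)
    then have g: "(\<gamma> has_derivative (\<lambda>c. c *s v)) (at \<zeta>)"
      by (subst has_derivative_componentwise_within) (auto simp: Basis_vec_def inner_axis)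
    have "\<gamma> \<zeta> \<in> S"
      using sub that by blast
    with f obtain D where D: "(f has_derivative D) (at (\<gamma> \<zeta>))" and lin: "\<forall>c v. D (c *s v) = c * D v"
      unfolding holo_fun_def by (metis (no_types, lifting))
    have "((\<lambda>\<zeta>. f (\<gamma> \<zeta>)) has_derivative (\<lambda>c. D (c *s v))) (at \<zeta>)"
      by (rule has_derivative_compose[OF g D])
    then show ?thesis
      by (auto simp: lin has_field_derivative_def mult_commute_abs)
  qed
  then show ?thesis
    using T holomorphic_on_open by blast
qed

text \<open>Serves \<open>ball_aut_inv\<close>: the inverse of the inverse is compared with the
  given map on the ball only, which suffices because the ball is open.\<close>

lemma holo_map_cong:
  fixes f :: "complex ^ 'n \<Rightarrow> complex ^ 'm"
  assumes "holo_map f unit_ball" "\<And>z. z \<in> unit_ball \<Longrightarrow> f z = g z"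
  shows "holo_map g unit_ball"
  unfolding holo_map_def holo_fun_def
proof (intro allI ballI)
  fix i and z :: "complex ^ 'n" assume z: "z \<in> unit_ball"
  obtain D where D: "((\<lambda>z. f z $ i) has_derivative D) (at z)" "\<forall>c v. D (c *s v) = c * D v"
    using assms(1) z unfolding holo_map_def holo_fun_def by blast
  have "((\<lambda>z. g z $ i) has_derivative D) (at z)"
    by (rule has_derivative_transform_within_open[OF D(1) _ z]) (auto simp: assms(2))
  with D(2) show "\<exists>D. ((\<lambda>z. g z $ i) has_derivative D) (at z) \<and> (\<forall>c v. D (c *s v) = c * D v)"
    by blast
qed

lemma ball_aut_inv:
  assumes "f \<in> ball_aut"
  shows "inv_into unit_ball f \<in> ball_aut"
proof -
  let ?g = "inv_into unit_ball f"
  have bij: "bij_betw f unit_ball unit_ball" and hf: "holo_map f unit_ball" "holo_map ?g unit_ball"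
    using assms by (auto simp: ball_aut_def)
  have bg: "bij_betw ?g unit_ball unit_ball"
    by (rule bij_betw_inv_into[OF bij])
  have "holo_map (inv_into unit_ball ?g) unit_ball"
    by (rule holo_map_cong[OF hf(1)]) (simp add: inv_into_inv_into_eq[OF bij])
  with bg hf show ?thesis
    by (simp add: ball_aut_def)
qed

text \<open>The left inverse \<open>q\<close> turns the Schwarz inequality for \<open>h\<close> into an equality at \<open>\<mu>\<close>.\<close>

lemma holomorphic_disc_with_left_inverse_is_linear:
  fixes h :: "complex \<Rightarrow> complex ^ 'n"
  assumes hol: "\<And>i. (\<lambda>\<zeta>. h \<zeta> $ i) holomorphic_on ball 0 1"
    and hB: "h ` ball 0 1 \<subseteq> unit_ball" and h0: "h 0 = 0"
    and q: "\<And>v. norm v = 1 \<Longrightarrow> (\<lambda>\<xi>. q (\<xi> *s v)) holomorphic_on ball 0 1"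
    and qD: "q ` unit_ball \<subseteq> ball 0 1"
    and qh: "\<And>\<zeta>. \<zeta> \<in> ball 0 1 \<Longrightarrow> q (h \<zeta>) = \<zeta>"
    and \<mu>: "\<mu> \<in> ball 0 1" "\<mu> \<noteq> 0" and axis: "\<And>i. i \<noteq> j \<Longrightarrow> h \<mu> $ i = 0"
    and \<zeta>: "\<zeta> \<in> ball 0 1" and ij: "i \<noteq> j"
  shows "h \<zeta> $ i = 0"
proof -
  have le: "norm (h \<zeta>) \<le> cmod \<zeta>" if "\<zeta> \<in> ball 0 1" for \<zeta>
  proof (cases "h \<zeta> = 0")
    case False
    \<comment> \<open>Pairing with the unit vector along \<open>h \<zeta>\<close> gives a scalar
      function whose value at \<zeta> has modulus \<open>norm (h \<zeta>)\<close>; the Schwarz lemma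
      bounds it.\<close>
    define u where "u = of_real (1 / norm (h \<zeta>)) *s h \<zeta>"
    have u: "norm u = 1"
      using False by (simp add: u_def norm_scale norm_divide)
    let ?F = "\<lambda>\<xi>. hinner (h \<xi>) u"
    have "?F holomorphic_on ball 0 1"
      unfolding hinner_def by (intro holomorphic_intros hol)
    moreover have "?F 0 = 0"
      by (simp add: hinner_def h0)
    moreover have "cmod (?F \<xi>) < 1" if "cmod \<xi> < 1" for \<xi>
      using cmod_hinner_le[of "h \<xi>" u] hB that u by force
    ultimately have "cmod (?F \<zeta>) \<le> cmod \<zeta>"
      using that by (intro Schwarz_Lemma(1)) auto
    moreover have "?F \<zeta> = of_real (1 / norm (h \<zeta>)) * hinner (h \<zeta>) (h \<zeta>)"
      by (simp add: hinner_def u_def sum_distrib_left mult_ac)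
    ultimately show ?thesis
      using False by (simp add: hinner_self norm_mult norm_divide power2_eq_square norm_power)
  qed simp
  have h\<mu>: "h \<mu> \<noteq> 0"
    using qh[OF \<mu>(1)] qh[of 0] h0 \<mu>(2) by force
  \<comment> \<open>On the complex line through \<open>h \<mu>\<close>, \<open>q\<close> is a
    self-map of the disc fixing 0. Schwarz at the parameter \<open>norm (h \<mu>)\<close>, where its
    value is \<mu>, gives the reverse inequality.\<close>
  define v where "v = of_real (1 / norm (h \<mu>)) *s h \<mu>"
  have v: "norm v = 1"
    using h\<mu> by (simp add: v_def norm_scale norm_divide)
  have q0: "q 0 = 0"
    using qh[of 0] h0 by simp
  have "(\<lambda>\<xi>. q (\<xi> *s v)) holomorphic_on ball 0 1"
    by (rule q[OF v])
  moreover have "cmod (q (\<xi> *s v)) < 1" if "cmod \<xi> < 1" for \<xi>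
  proof -
    have "\<xi> *s v \<in> unit_ball" using that by (simp add: norm_scale v)
    then show ?thesis using qD by force
  qed
  moreover have "cmod (of_real (norm (h \<mu>))) < 1"
    using hB \<mu>(1) by force
  ultimately have "cmod (q (of_real (norm (h \<mu>)) *s v)) \<le> cmod (of_real (norm (h \<mu>)))"
    by (intro Schwarz_Lemma(1)) (auto simp: q0)
  moreover have "of_real (norm (h \<mu>)) *s v = h \<mu>"
    using h\<mu> by (simp add: v_def vec_eq_iff)
  ultimately have "cmod \<mu> \<le> norm (h \<mu>)"
    using qh[OF \<mu>(1)] by simp
  then have eq: "norm (h \<mu>) = cmod \<mu>"
    using le[OF \<mu>(1)] by simp
  have comp: "(norm (h \<zeta>))\<^sup>2 = (\<Sum>i\<in>UNIV. (cmod (h \<zeta> $ i))\<^sup>2)" for \<zeta>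
    by (simp add: norm_vec_def L2_set_def sum_nonneg)
  have "(\<Sum>i\<in>UNIV. (cmod (h \<mu> $ i))\<^sup>2) = (\<Sum>i\<in>{j}. (cmod (h \<mu> $ i))\<^sup>2)"
    by (rule sum.mono_neutral_right) (auto simp: axis)
  then have "cmod (h \<mu> $ j) = cmod \<mu>"
    using comp[of \<mu>] eq by simp
  moreover have "cmod (h \<xi> $ j) < 1" if "cmod \<xi> < 1" for \<xi>
    using Finite_Cartesian_Product.norm_nth_le[of "h \<xi>" j] hB that by force
  \<comment> \<open>All of \<open>norm (h \<mu>) = cmod \<mu>\<close> sits in coordinate
    \<open>j\<close>, so this coordinate attains equality in the Schwarz lemma and is a
    rotation.\<close>
  ultimately obtain \<alpha> where \<alpha>: "\<And>z. cmod z < 1 \<Longrightarrow> h z $ j = \<alpha> * z" "cmod \<alpha> = 1"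
    using Schwarz_Lemma(3)[of "\<lambda>z. h z $ j" 0] hol[of j] h0 \<mu> by auto
  \<comment> \<open>The rotation already exhausts the bound \<open>cmod \<zeta>\<close> on the norm,
    which leaves nothing for coordinate \<open>i\<close>.\<close>
  have "(\<Sum>i\<in>{i,j}. (cmod (h \<zeta> $ i))\<^sup>2) \<le> (norm (h \<zeta>))\<^sup>2"
    unfolding comp by (rule sum_mono2) auto
  also have "\<dots> \<le> (cmod \<zeta>)\<^sup>2"
    using le[OF \<zeta>] by (simp add: power_mono)
  also have "\<dots> = (cmod (h \<zeta> $ j))\<^sup>2"
    using \<alpha> \<zeta> by (simp add: norm_mult)
  finally show ?thesis
    using ij by simp
qed

lemma ball_aut_mem: "f \<in> ball_aut \<Longrightarrow> z \<in> unit_ball \<Longrightarrow> f z \<in> unit_ball"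
  by (auto simp: ball_aut_def dest: bij_betwE)

lemma ball_aut_inv_left: "f \<in> ball_aut \<Longrightarrow> z \<in> unit_ball \<Longrightarrow> inv_into unit_ball f (f z) = z"
  by (auto simp: ball_aut_def bij_betw_def)

lemma ball_aut_curve:
  assumes "f \<in> ball_aut" "\<And>i. (\<lambda>\<zeta>. \<gamma> \<zeta> $ i) holomorphic_on ball 0 1" "\<gamma> ` ball 0 1 \<subseteq> unit_ball"
  shows "(\<lambda>\<zeta>. f (\<gamma> \<zeta>) $ i) holomorphic_on ball 0 1" "(\<lambda>\<zeta>. f (\<gamma> \<zeta>)) ` ball 0 1 \<subseteq> unit_ball"
proof -
  show "(\<lambda>\<zeta>. f (\<gamma> \<zeta>) $ i) holomorphic_on ball 0 1"
    using assms by (intro holo_fun_compose_curve[where f = "\<lambda>z. f z $ i" and S = unit_ball])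
      (auto simp: ball_aut_def holo_map_def)
  show "(\<lambda>\<zeta>. f (\<gamma> \<zeta>)) ` ball 0 1 \<subseteq> unit_ball"
    using assms ball_aut_mem by blast
qed

text \<open>Reparametrising the axis by a Moebius map turns its image under \<open>f\<close> after
  \<open>g\<close> into a disc \<open>h\<close> with \<open>h 0 = 0\<close>. Undoing all maps gives
  the left inverse \<open>q\<close>, and the rigidity of such discs, applied at the parameter of
  \<open>z2\<close>, puts the whole disc on axis \<open>k\<close>.\<close>

lemma ball_aut_maps_axis_to_axis:
  fixes f g :: "complex ^ 'n \<Rightarrow> complex ^ 'n"
  assumes f: "f \<in> ball_aut" and g: "g \<in> ball_aut"
    and D: "z1 \<in> unit_ball" "z2 \<in> unit_ball" "z3 \<in> unit_ball"
    and axis: "\<And>i. i \<noteq> j \<Longrightarrow> z1 $ i = 0" "\<And>i. i \<noteq> j \<Longrightarrow> z2 $ i = 0" "\<And>i. i \<noteq> j \<Longrightarrow> z3 $ i = 0"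
    and f1: "f (g z1) = 0" and f2: "f (g z2) \<noteq> 0" "\<And>i. i \<noteq> k \<Longrightarrow> f (g z2) $ i = 0"
    and i: "i \<noteq> k"
  shows "f (g z3) $ i = 0"
proof -
  define a where "a = z1 $ j"
  \<comment> \<open>\<open>M\<close> takes 0 to \<open>a\<close>, the parameter of
    \<open>z1\<close>; \<open>N\<close> is its inverse and takes \<open>a\<close> to 0.\<close>
  define M where "M = Moebius_function 0 (- a)"
  define N where "N = Moebius_function 0 a"
  define E where "E = (\<lambda>\<zeta>. (axis j \<zeta> :: complex ^ 'n))"
  define h where "h = (\<lambda>\<zeta>. f (g (E (M \<zeta>))))"
  define q where "q = (\<lambda>v. N (inv_into unit_ball g (inv_into unit_ball f v) $ j))"
  have lt: "cmod (z $ j) < 1" if "z \<in> unit_ball" for z :: "complex ^ 'n"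
    using Finite_Cartesian_Product.norm_nth_le[of z j] that by simp
  have a: "cmod a < 1"
    using lt D(1) by (simp add: a_def)
  have M: "cmod (M \<zeta>) < 1" if "cmod \<zeta> < 1" for \<zeta>
    using a that unfolding M_def by (intro Moebius_function_norm_lt_1) auto
  have N: "cmod (N \<zeta>) < 1" if "cmod \<zeta> < 1" for \<zeta>
    using a that unfolding N_def by (intro Moebius_function_norm_lt_1) auto
  have NM: "N (M \<zeta>) = \<zeta>" and MN: "M (N \<zeta>) = \<zeta>" if "cmod \<zeta> < 1" for \<zeta>
    using a that unfolding N_def M_def by (auto intro!: Moebius_function_compose)
  have M_hol: "M holomorphic_on ball 0 1" and N_hol: "N holomorphic_on ball 0 1"
    using a unfolding M_def N_def by (auto intro!: Moebius_function_holomorphic)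
  have normE: "norm (E \<zeta>) = cmod \<zeta>" for \<zeta>
    by (simp add: E_def norm_eq_sqrt_inner inner_axis_axis)
  have E: "E (z $ j) = z" if "\<And>i. i \<noteq> j \<Longrightarrow> z $ i = 0" for z
    using that by (auto simp: E_def vec_eq_iff axis_def)
  have curve: "(\<lambda>\<zeta>. E (M \<zeta>) $ i) holomorphic_on ball 0 1" for i
    using M_hol by (cases "i = j") (auto simp: E_def axis_def)
  have curveB: "(\<lambda>\<zeta>. E (M \<zeta>)) ` ball 0 1 \<subseteq> unit_ball"
    using M by (auto simp: normE)
  note gcurve = ball_aut_curve[OF g curve curveB]
  note hcurve = ball_aut_curve[OF f gcurve]
  have hN: "h (N (z $ j)) = f (g z)" if "z \<in> unit_ball" "\<And>i. i \<noteq> j \<Longrightarrow> z $ i = 0" for z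
    using that by (simp add: h_def MN lt E)
  have Na: "N a = 0"
    by (simp add: N_def Moebius_function_eq_zero)
  have ND: "N (z $ j) \<in> ball 0 1" if "z \<in> unit_ball" for z :: "complex ^ 'n"
    using N lt that by simp
  have h0: "h 0 = 0"
    using hN[OF D(1) axis(1)] f1 by (simp add: Na a_def[symmetric])
  have hh: "h (N (z2 $ j)) = f (g z2)"
    by (rule hN[OF D(2) axis(2)])
  have "h (N (z3 $ j)) $ i = 0"
  proof (rule holomorphic_disc_with_left_inverse_is_linear[of h q "N (z2 $ j)" k "N (z3 $ j)" i])
    show "(\<lambda>\<zeta>. h \<zeta> $ i) holomorphic_on ball 0 1" for i
      unfolding h_def by (rule hcurve)
    show "h ` ball 0 1 \<subseteq> unit_ball"
      unfolding h_def by (rule hcurve)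
    show "(\<lambda>\<xi>. q (\<xi> *s v)) holomorphic_on ball 0 1" if v: "norm v = 1" for v
    proof -
      have 1: "(\<lambda>\<zeta>. (\<zeta> *s v) $ i) holomorphic_on ball 0 1" for i
        by (auto intro!: holomorphic_intros)
      have 2: "(\<lambda>\<zeta>. \<zeta> *s v) ` ball 0 1 \<subseteq> unit_ball"
        by (auto simp: norm_scale v)
      note c = ball_aut_curve[OF ball_aut_inv[OF g] ball_aut_curve[OF ball_aut_inv[OF f] 1 2]]
      have "(N \<circ> (\<lambda>\<xi>. inv_into unit_ball g (inv_into unit_ball f (\<xi> *s v)) $ j)) holomorphic_on ball 0 1"
        by (rule holomorphic_on_compose_gen[OF c(1) N_hol]) (use c(2) lt in auto)
      then show ?thesis by (simp add: q_def o_def)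
    qed
    show "q ` unit_ball \<subseteq> ball 0 1"
      unfolding q_def using ball_aut_mem[OF ball_aut_inv[OF g]] ball_aut_mem[OF ball_aut_inv[OF f]] lt N
      by force
    show "q (h \<zeta>) = \<zeta>" if "\<zeta> \<in> ball 0 1" for \<zeta>
    proof -
      have "E (M \<zeta>) \<in> unit_ball" "cmod \<zeta> < 1"
        using M that by (auto simp: normE)
      then show ?thesis
        by (simp only: q_def h_def ball_aut_inv_left[OF f ball_aut_mem[OF g]] ball_aut_inv_left[OF g] NM)
          (simp add: E_def NM)
    qed
    show "N (z2 $ j) \<noteq> 0"
      using hh h0 f2(1) by force
  qed (use ND D h0 hh f2(2) i in auto)
  then show ?thesis
    using hN[OF D(3)] axis(3) by simp
qed

lemma normal_triple_coordinates:
  assumes "normal_triple s w t x"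
  shows "x 1 $ 1 = 0" "x 1 $ 2 = 0" "x 2 $ 1 = of_real s" "x 2 $ 2 = 0" "x 3 $ 1 = w" "x 3 $ 2 = of_real t"
  using assms by (auto simp: normal_triple_def)

text \<open>The normalising automorphism \<open>f\<close> sends the first point to 0 and the second
  to a nonzero point of the first axis. If the points lie on a geodesic, \<open>f\<close> therefore
  sends the third to that axis too, so t = 0. Conversely, the inverse of \<open>f\<close> exhibits
  the geodesic.\<close>

lemma complex_geodesic_iff_class_E:
  fixes e :: "nat \<Rightarrow> 'n::finite"
  assumes e: "bij_betw e {1..CARD('n)} UNIV" and yB: "points y \<subseteq> unit_ball"
    and nf: "normal_form e y x"
  shows "(\<exists>G. complex_geodesic e G \<and> points y \<subseteq> G) \<longleftrightarrow> x \<in> class_E"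
proof -
  obtain s w t where nt: "normal_triple s w t x"
    using nf by (auto simp: normal_form_def)
  obtain f where f: "f \<in> ball_aut"
    and fy: "\<And>i. i \<in> {1,2,3} \<Longrightarrow> coord e (f (y i)) 1 = x i $ 1 \<and>
               coord e (f (y i)) 2 = x i $ 2 \<and> (\<forall>k>2. coord e (f (y i)) k = 0)"
    using nf unfolding normal_form_def by blast
  note nc = normal_triple_coordinates[OF nt]
  let ?D = "{z \<in> unit_ball. \<forall>k\<ge>2. coord e z k = 0}"
  have card: "1 \<le> CARD('n)"
    by (simp add: Suc_leI)
  have coord_e: "\<exists>k\<ge>1. i = e k \<and> (\<forall>z. coord e z k = z $ i)" for i
  proof -
    have "i \<in> e ` {1..CARD('n)}"
      using e by (simp add: bij_betw_def)
    then show ?thesis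
      by (auto simp: coord_def)
  qed
  have off: "\<exists>k\<ge>2. \<forall>z. coord e z k = z $ i" if "i \<noteq> e 1" for i
  proof -
    obtain k where k: "k \<ge> 1" "i = e k" "\<And>z. coord e z k = z $ i"
      using coord_e[of i] by blast
    then have "k \<ge> 2"
      using that by (cases "k = 1") auto
    with k show ?thesis by blast
  qed
  have c1: "coord e z 1 = z $ e 1" for z
    using card by (simp add: coord_def)
  have y: "y 1 \<in> unit_ball" "y 2 \<in> unit_ball" "y 3 \<in> unit_ball"
    using yB by auto
  show ?thesis
  proof
    assume "\<exists>G. complex_geodesic e G \<and> points y \<subseteq> G"
    then obtain g where g: "g \<in> ball_aut" and "points y \<subseteq> g ` ?D"
      by (auto simp: complex_geodesic_def)
    then obtain z1 z2 z3 where z: "z1 \<in> ?D" "z2 \<in> ?D" "z3 \<in> ?D" "y 1 = g z1" "y 2 = g z2" "y 3 = g z3"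
      by (auto simp: image_iff)
    have axis: "z $ i = 0" if "z \<in> ?D" "i \<noteq> e 1" for z i
      using off[OF that(2)] that(1) by force
    have x2: "coord e (f (y i)) k = 0" if "i \<in> {1,2}" "k \<ge> 2" for i k
      using fy[of i] nc that by (cases "k = 2") auto
    have f2: "f (g z2) $ i = 0" if "i \<noteq> e 1" for i
      using off[OF that] x2[of 2] z by force
    have "f (g z1) $ i = 0" for i
      using off[of i] x2[of 1] z fy[of 1] nc c1 by (cases "i = e 1") force+
    then have f1: "f (g z1) = 0"
      by (simp add: vec_eq_iff)
    have "f (g z2) $ e 1 = of_real s"
      using fy[of 2] nc c1 z by auto
    then have f20: "f (g z2) \<noteq> 0"
      using nt by (auto simp: normal_triple_def)
    have f3: "f (g z3) $ i = 0" if "i \<noteq> e 1" for i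
      by (rule ball_aut_maps_axis_to_axis[OF f g, of z1 z2 z3 "e 1" "e 1"])
        (use z(1,2,3) axis f1 f20 f2 that in blast)+
    \<comment> \<open>In dimension one, \<open>coord\<close> makes the second coordinate 0 by
      convention.\<close>
    have "coord e (f (y 3)) 2 = 0"
    proof (cases "2 \<le> CARD('n)")
      case True
      then have "e 2 \<noteq> e 1"
        using inj_onD[OF bij_betw_imp_inj_on[OF e], of 2 1] True by auto
      then show ?thesis
        using f3[of "e 2"] z(6) True by (simp add: coord_def)
    qed (simp add: coord_def)
    then have "t = 0"
      using fy[of 3] nc by simp
    then show "x \<in> class_E"
      using nt by (auto simp: class_E_def)
  next
    assume "x \<in> class_E"
    then have x0: "x i $ 2 = 0" if "i \<in> {1,2,3}" for i
      using that by (auto simp: class_E_def dest: normal_triple_coordinates)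
    let ?g = "inv_into unit_ball f"
    have "f (y i) \<in> ?D \<and> y i = ?g (f (y i))" if "i \<in> {1,2,3}" for i
    proof -
      have "coord e (f (y i)) k = 0" if "k \<ge> 2" for k
        using fy[OF \<open>i \<in> {1,2,3}\<close>] x0[OF \<open>i \<in> {1,2,3}\<close>] that by (cases "k = 2") auto
      moreover have "y i \<in> unit_ball"
        using yB that by blast
      ultimately show ?thesis
        using ball_aut_mem[OF f] ball_aut_inv_left[OF f] by auto
    qed
    then have "points y \<subseteq> ?g ` ?D"
      by blast
    moreover have "complex_geodesic e (?g ` ?D)"
      unfolding complex_geodesic_def using ball_aut_inv[OF f] by blast
    ultimately show "\<exists>G. complex_geodesic e G \<and> points y \<subseteq> G"
      by blast
  qed
qed

section \<open>Multiplier norms on finite sets of points\<close>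

definition comb :: "(complex ^ 2) set \<Rightarrow> (complex ^ 2 \<Rightarrow> complex) \<Rightarrow> complex ^ 2 \<Rightarrow> complex" where
  "comb X c = (\<lambda>z. \<Sum>p\<in>X. c p * da_kernel p z)"

text \<open>This is the squared norm of \<open>comb X c\<close> (see \<open>N_square\<close>),
  written through kernel values alone so that it can be computed explicitly.\<close>

definition gram_form :: "(complex ^ 2) set \<Rightarrow> (complex ^ 2 \<Rightarrow> complex) \<Rightarrow> real" where
  "gram_form X c = Re (\<Sum>q\<in>X. cnj (c q) * comb X c q)"

lemma comb_scale: "comb X (\<lambda>p. a * c p) z = a * comb X c z"
  by (simp add: comb_def sum_distrib_left mult_ac)

lemma kernel_span_eq: "kernel_span X = range (comb X)"
  by (auto simp: kernel_span_def comb_def)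

section \<open>Inner product calculus and the Cauchy-Schwarz inequality\<close>

locale hilbert_functions =
  fixes B :: "'a set" and H :: "('a \<Rightarrow> complex) set" and ip :: "'a ip"
  assumes hfs: "hilbert_function_space B H ip"
begin

lemma pre_hilbert:
  "(\<lambda>z. 0) \<in> H"
  "\<forall>f\<in>H. \<forall>g\<in>H. (\<lambda>z. f z + g z) \<in> H"
  "\<forall>c. \<forall>f\<in>H. (\<lambda>z. c * f z) \<in> H"
  "\<forall>f\<in>H. \<forall>g\<in>H. \<forall>h\<in>H. ip (\<lambda>z. f z + g z) h = ip f h + ip g h"
  "\<forall>c. \<forall>f\<in>H. \<forall>h\<in>H. ip (\<lambda>z. c * f z) h = c * ip f h"
  "\<forall>f\<in>H. \<forall>g\<in>H. ip g f = cnj (ip f g)"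
  "\<forall>f\<in>H. 0 \<le> Re (ip f f)"
  "\<forall>f\<in>H. ip f f = 0 \<longrightarrow> f = (\<lambda>z. 0)"
  using hfs unfolding hilbert_function_space_def by - (elim conjE, assumption)+

lemmas zero_mem = pre_hilbert(1)
  and add_mem = pre_hilbert(2)[rule_format]
  and scale_mem = pre_hilbert(3)[rule_format]
  and ip_add = pre_hilbert(4)[rule_format]
  and ip_scale = pre_hilbert(5)[rule_format]
  and ip_cnj = pre_hilbert(6)[rule_format]
  and ip_nonneg = pre_hilbert(7)[rule_format]
  and ip_definite = pre_hilbert(8)[rule_format]

lemma ip_zero: "h \<in> H \<Longrightarrow> ip (\<lambda>z. 0) h = 0"
  using ip_scale[of "\<lambda>z. 0" h 0] zero_mem by simp

lemma ip_self: "f \<in> H \<Longrightarrow> ip f f = of_real (Re (ip f f))"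
  using ip_cnj[of f f] by (simp add: complex_eq_iff)

lemma ip_add_right: "f \<in> H \<Longrightarrow> g \<in> H \<Longrightarrow> h \<in> H \<Longrightarrow> ip h (\<lambda>z. f z + g z) = ip h f + ip h g"
  by (simp only: ip_cnj[OF add_mem] ip_cnj[of f h] ip_cnj[of g h] ip_add complex_cnj_add)

lemma ip_scale_right: "f \<in> H \<Longrightarrow> h \<in> H \<Longrightarrow> ip h (\<lambda>z. c * f z) = cnj c * ip h f"
  by (simp only: ip_cnj[OF scale_mem] ip_cnj[of f h] ip_scale complex_cnj_mult)

lemma sum_mem: "finite S \<Longrightarrow> (\<And>p. p \<in> S \<Longrightarrow> f p \<in> H) \<Longrightarrow> (\<lambda>z. \<Sum>p\<in>S. c p * f p z) \<in> H"
proof (induction S rule: finite_induct)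
  case (insert a S)
  then have "(\<lambda>z. c a * f a z + (\<Sum>p\<in>S. c p * f p z)) \<in> H"
    by (intro add_mem scale_mem[of "f a"]) auto
  then show ?case
    using insert.hyps by simp
qed (simp add: zero_mem)

lemma ip_sum:
  "finite S \<Longrightarrow> (\<And>p. p \<in> S \<Longrightarrow> f p \<in> H) \<Longrightarrow> h \<in> H \<Longrightarrow>
     ip (\<lambda>z. \<Sum>p\<in>S. c p * f p z) h = (\<Sum>p\<in>S. c p * ip (f p) h)"
proof (induction S rule: finite_induct)
  case (insert a S)
  have "(\<lambda>z. \<Sum>p\<in>insert a S. c p * f p z) = (\<lambda>z. c a * f a z + (\<Sum>p\<in>S. c p * f p z))"
    using insert.hyps by simp
  moreover have "(\<lambda>z. \<Sum>p\<in>S. c p * f p z) \<in> H" "(\<lambda>z. c a * f a z) \<in> H"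
    using insert by (auto intro!: sum_mem scale_mem[of "f a"])
  ultimately show ?case
    using insert by (simp only: ip_add) (simp add: ip_scale[of "f a"])
qed (simp add: ip_zero)

lemma Cauchy_Schwarz:
  assumes f: "f \<in> H" and g: "g \<in> H"
  shows "cmod (ip f g) \<le> ip_norm ip f * ip_norm ip g"
proof (cases "Re (ip g g) = 0")
  case True
  then have "g = (\<lambda>z. 0)"
    using ip_self[OF g] ip_definite[OF g] by simp
  then have "ip f g = 0"
    using ip_cnj[OF g f] ip_zero[OF f] by simp
  then show ?thesis
    using ip_nonneg f g by (simp add: ip_norm_def)
next
  case False
  define \<gamma> where "\<gamma> = Re (ip g g)"
  define \<phi> where "\<phi> = Re (ip f f)"
  define a where "a = ip f g"
  \<comment> \<open>This is \<gamma> times the component of \<open>f\<close> orthogonal to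
    \<open>g\<close>; nonnegativity of its squared norm is the claim.\<close>
  define k where "k = (\<lambda>z. of_real \<gamma> * f z + (- a) * g z)"
  have \<gamma>: "\<gamma> > 0" and gg: "ip g g = of_real \<gamma>" and ff: "ip f f = of_real \<phi>" and gf: "ip g f = cnj a"
    using False ip_nonneg[OF g] ip_self[OF g] ip_self[OF f] ip_cnj[OF f g]
    by (auto simp: \<gamma>_def \<phi>_def a_def)
  have 1: "(\<lambda>z. of_real \<gamma> * f z) \<in> H" "(\<lambda>z. (- a) * g z) \<in> H"
    by (rule scale_mem[OF f], rule scale_mem[OF g])
  have k: "k \<in> H"
    unfolding k_def by (rule add_mem[OF 1])
  have "ip k k = of_real \<gamma> * (of_real \<gamma> * of_real \<phi> + (- cnj a) * a)
      + (- a) * (of_real \<gamma> * cnj a + (- cnj a) * of_real \<gamma>)"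
  proof -
    have "ip k h = of_real \<gamma> * ip f h + (- a) * ip g h" if "h \<in> H" for h
      unfolding k_def by (simp only: ip_add[OF 1 that] ip_scale[OF f that] ip_scale[OF g that])
    moreover have "ip h k = of_real \<gamma> * ip h f + (- cnj a) * ip h g" if "h \<in> H" for h
      unfolding k_def by (simp only: ip_add_right[OF 1 that] ip_scale_right[OF f that]
          ip_scale_right[OF g that] complex_cnj_complex_of_real complex_cnj_minus)
    ultimately show ?thesis
      using f g k by (simp only: ff gg gf a_def[symmetric]) (simp add: algebra_simps)
  qed
  also have "\<dots> = of_real (\<gamma> * (\<gamma> * \<phi> - (cmod a)\<^sup>2))"
    by (simp only: of_real_mult of_real_diff complex_norm_square) (simp add: algebra_simps)
  finally have "0 \<le> \<gamma> * (\<gamma> * \<phi> - (cmod a)\<^sup>2)"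
    using ip_nonneg[OF k] by (metis Re_complex_of_real)
  then have "(cmod a)\<^sup>2 \<le> \<phi> * \<gamma>"
    using \<gamma> by (simp add: zero_le_mult_iff mult.commute)
  then show ?thesis
    unfolding ip_norm_def a_def[symmetric] \<phi>_def[symmetric] \<gamma>_def[symmetric] real_sqrt_mult[symmetric]
    by (rule real_le_rsqrt)
qed

end

text \<open>\<open>full\<close> expresses linear independence of the kernel functions at the points
  of \<open>X\<close>: interpolation is always possible, so every function on \<open>X\<close> is a
  multiplier.\<close>

locale da_points =
  fixes DA2 :: "(complex ^ 2 \<Rightarrow> complex) set" and ip :: "(complex ^ 2) ip" and X :: "(complex ^ 2) set"
  assumes da: "drury_arveson_2 DA2 ip"
    and fin: "finite X" and sub: "X \<subseteq> unit_ball"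
    and full: "functions_on X \<subseteq> DA2X X"

sublocale da_points \<subseteq> hilbert_functions "unit_ball" DA2 ip
  using da by unfold_locales (simp add: drury_arveson_2_def)

context da_points
begin

abbreviation "N c \<equiv> ip_norm ip (comb X c)"

lemma kernel_mem: "p \<in> X \<Longrightarrow> da_kernel p \<in> DA2"
  and reproducing: "p \<in> X \<Longrightarrow> f \<in> DA2 \<Longrightarrow> ip f (da_kernel p) = f p"
  using da sub unfolding drury_arveson_2_def by (auto simp: subset_iff)

lemma comb_mem: "comb X c \<in> DA2"
  unfolding comb_def by (rule sum_mem[OF fin kernel_mem])

lemma ip_comb_right: "f \<in> DA2 \<Longrightarrow> ip f (comb X c) = (\<Sum>p\<in>X. cnj (c p) * f p)"
proof -
  assume f: "f \<in> DA2"
  have "ip (comb X c) f = (\<Sum>p\<in>X. c p * ip (da_kernel p) f)"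
    unfolding comb_def by (rule ip_sum[OF fin kernel_mem f])
  also have "\<dots> = (\<Sum>p\<in>X. c p * cnj (f p))"
    using ip_cnj[OF f kernel_mem] reproducing f by (intro sum.cong) auto
  finally show ?thesis
    using ip_cnj[OF comb_mem f, of c] by simp
qed

lemma N_square: "(N c)\<^sup>2 = gram_form X c"
  using ip_nonneg[OF comb_mem, of c] by (simp add: ip_norm_def gram_form_def ip_comb_right[OF comb_mem])

lemma N_nonneg: "0 \<le> N c"
  using ip_nonneg[OF comb_mem, of c] by (simp add: ip_norm_def)

lemma N_scale: "N (\<lambda>p. a * c p) = cmod a * N c"
proof -
  have "(N (\<lambda>p. a * c p))\<^sup>2 = Re (\<Sum>q\<in>X. a * cnj a * (cnj (c q) * comb X c q))"
    by (simp add: N_square gram_form_def comb_scale mult_ac)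
  also have "\<dots> = (cmod a * N c)\<^sup>2"
    unfolding sum_distrib_left[symmetric] power_mult_distrib N_square gram_form_def
    by (simp flip: complex_norm_square)
  finally show ?thesis
    using N_nonneg by (simp add: power2_eq_iff_nonneg)
qed

text \<open>The difference vanishes on \<open>X\<close>, so by the reproducing property it is
  orthogonal to the kernel span, in particular to itself.\<close>

lemma comb_eqI:
  assumes "\<And>p. p \<in> X \<Longrightarrow> comb X c p = comb X d p"
  shows "comb X c = comb X d"
proof -
  let ?e = "\<lambda>p. c p - d p"
  have e: "comb X ?e z = comb X c z - comb X d z" for z
    by (simp add: comb_def sum_subtractf left_diff_distrib)
  have "ip (comb X ?e) (comb X ?e) = 0"
    using assms by (simp add: ip_comb_right[OF comb_mem] e)
  then have "comb X ?e = (\<lambda>z. 0)"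
    by (rule ip_definite[OF comb_mem])
  then show ?thesis
    using e by (auto simp: fun_eq_iff)
qed

lemma DA2X_norm_restr: "DA2X_norm ip X (restr X (comb X c)) = N c"
proof -
  have "(THE F. F \<in> kernel_span X \<and> restr X F = restr X (comb X c)) = comb X c"
  proof (rule the_equality)
    fix F assume "F \<in> kernel_span X \<and> restr X F = restr X (comb X c)"
    then obtain d where "F = comb X d" and "restr X (comb X d) = restr X (comb X c)"
      by (auto simp: kernel_span_eq)
    moreover from this(2) have "comb X d p = comb X c p" if "p \<in> X" for p
      using that by (simp add: restr_def fun_eq_iff) metis
    ultimately show "F = comb X c"
      using comb_eqI by blast
  qed (auto simp: kernel_span_eq)
  then show ?thesis
    by (simp add: DA2X_norm_def)
qed

lemma interpolate: "\<exists>c. \<forall>p\<in>X. comb X c p = v p"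
proof -
  have "restr X v \<in> functions_on X"
    by (simp add: functions_on_def restr_def)
  then obtain c where c: "restr X v = restr X (comb X c)"
    using full by (auto simp: DA2X_def kernel_span_eq)
  have "v p = comb X c p" if "p \<in> X" for p
    using fun_cong[OF c, of p] that by (simp add: restr_def)
  then show ?thesis by metis
qed

section \<open>Multiplication operators, their norms and adjoints\<close>

lemma Mult_eq: "Mult X = functions_on X"
  using full by (auto simp: Mult_def functions_on_def DA2X_def restr_def subset_iff)

text \<open>Multiplication by \<open>m\<close> in terms of coefficients; a relation, so that no
  choice of coefficients of the product has to be made.\<close>

definition mult_rel :: "(complex ^ 2 \<Rightarrow> complex) \<Rightarrow> (complex ^ 2 \<Rightarrow> complex) \<Rightarrow> (complex ^ 2 \<Rightarrow> complex) \<Rightarrow> bool" where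
  "mult_rel m c d \<longleftrightarrow> (\<forall>p\<in>X. comb X d p = m p * comb X c p)"

lemma mult_norm_eq: "mult_norm ip X m = Sup {N d | c d. mult_rel m c d \<and> N c \<le> 1}"
proof -
  have rel: "restr X (comb X d) = (\<lambda>z. m z * restr X (comb X c) z) \<longleftrightarrow> mult_rel m c d" for c d
    by (auto simp: mult_rel_def restr_def fun_eq_iff)
  have "{DA2X_norm ip X (\<lambda>z. m z * h z) | h. h \<in> DA2X X \<and> DA2X_norm ip X h \<le> 1}
      = {DA2X_norm ip X (\<lambda>z. m z * restr X (comb X c) z) | c. N c \<le> 1}"
    by (auto simp: DA2X_def kernel_span_eq DA2X_norm_restr)
  also have "\<dots> = {N d | c d. mult_rel m c d \<and> N c \<le> 1}"
  proof -
    have "\<exists>d. mult_rel m c d" for c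
      using interpolate[of "\<lambda>p. m p * comb X c p"] by (simp add: mult_rel_def)
    moreover have "DA2X_norm ip X (\<lambda>z. m z * restr X (comb X c) z) = N d" if "mult_rel m c d" for c d
      using that DA2X_norm_restr[of d] unfolding rel[symmetric] by metis
    ultimately show ?thesis
      by (intro set_eqI iffI; clarsimp) metis+
  qed
  finally show ?thesis
    by (simp only: mult_norm_def)
qed

lemma comb_bound: "p \<in> X \<Longrightarrow> cmod (comb X c p) \<le> N c * ip_norm ip (da_kernel p)"
  using Cauchy_Schwarz[OF comb_mem[of c] kernel_mem] reproducing[OF _ comb_mem] by metis

text \<open>The real \<open>Sup\<close> carries information only for a bounded set. Point
  evaluations bound the values of \<open>comb X d\<close>, and on a finite set the values bound the
  norm through a dual basis.\<close>

lemma mult_norm_bdd: "bdd_above {N d | c d. mult_rel m c d \<and> N c \<le> 1}"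
proof -
  \<comment> \<open>\<open>E q\<close> holds the coefficients of the function that is 1 at
    \<open>q\<close> and 0 at the other points of \<open>X\<close>.\<close>
  obtain E where E: "\<And>q p. p \<in> X \<Longrightarrow> comb X (E q) p = (if p = q then 1 else 0)"
    using interpolate[of "\<lambda>p. if p = _ then 1 else 0"] by metis
  define b where "b p = cmod (m p) * ip_norm ip (da_kernel p)" for p
  have "N d \<le> sqrt (\<Sum>p\<in>X. \<Sum>q\<in>X. b q * cmod (E q p) * b p)" if r: "mult_rel m c d" and c: "N c \<le> 1" for c d
  proof -
    define v where "v = comb X d"
    have v: "cmod (v p) \<le> b p" if p: "p \<in> X" for p
    proof -
      have "cmod (comb X c p) \<le> ip_norm ip (da_kernel p)"
        using comb_bound[OF p, of c] c ip_nonneg[OF kernel_mem[OF p]] N_nonneg[of c]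
        by (smt (verit) ip_norm_def mult_left_le_one_le real_sqrt_ge_zero)
      then show ?thesis
        using r p by (simp add: mult_rel_def v_def b_def norm_mult mult_left_mono)
    qed
    define d' where "d' = (\<lambda>p. \<Sum>q\<in>X. v q * E q p)"
    have "comb X d' p = v p" if "p \<in> X" for p
    proof -
      have "comb X d' p = (\<Sum>q\<in>X. v q * comb X (E q) p)"
        unfolding comb_def d'_def sum_distrib_left sum_distrib_right
        by (subst sum.swap) (simp add: mult_ac)
      also have "\<dots> = (\<Sum>q\<in>X. if p = q then v q else 0)"
        using that by (intro sum.cong) (auto simp: E)
      finally show ?thesis
        using fin that by simp
    qed
    then have d: "comb X d = comb X d'"
      unfolding v_def by (intro comb_eqI) simp
    have "(N d)\<^sup>2 = Re (\<Sum>p\<in>X. cnj (d' p) * v p)"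
      by (simp only: d N_square gram_form_def v_def)
    also have "\<dots> \<le> cmod (\<Sum>p\<in>X. cnj (d' p) * v p)"
      by (rule complex_Re_le_cmod)
    also have "\<dots> \<le> (\<Sum>p\<in>X. \<Sum>q\<in>X. b q * cmod (E q p) * b p)"
    proof (rule sum_norm_le)
      fix p assume p: "p \<in> X"
      have "cmod (d' p) \<le> (\<Sum>q\<in>X. b q * cmod (E q p))"
        unfolding d'_def by (rule sum_norm_le) (simp add: norm_mult v mult_right_mono)
      then have "cmod (d' p) * cmod (v p) \<le> (\<Sum>q\<in>X. b q * cmod (E q p)) * b p"
        using v[OF p] by (intro mult_mono) (auto intro!: order_trans[OF norm_ge_zero])
      then show "cmod (cnj (d' p) * v p) \<le> (\<Sum>q\<in>X. b q * cmod (E q p) * b p)"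
        by (simp add: norm_mult sum_distrib_right)
    qed
    finally show ?thesis
      by (rule real_le_rsqrt)
  qed
  then show ?thesis
    by (intro bdd_aboveI) blast
qed

text \<open>Homogeneity replaces the supremum over the unit ball by an inequality for all
  \<open>c\<close>. Combinations of norm 0 cannot be normalised and are treated apart: they vanish
  on \<open>X\<close>, hence so does the product.\<close>

lemma mult_norm_le_iff:
  assumes r: "0 \<le> r"
  shows "mult_norm ip X m \<le> r \<longleftrightarrow> (\<forall>c d. mult_rel m c d \<longrightarrow> N d \<le> r * N c)"
proof -
  let ?S = "{N d | c d. mult_rel m c d \<and> N c \<le> 1}"
  have zero: "mult_rel m (\<lambda>_. 0) (\<lambda>_. 0)" "N (\<lambda>_. 0) = 0"
    using N_scale[of 0] by (auto simp: mult_rel_def comb_def)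
  then have ne: "?S \<noteq> {}"
    by force
  have "N d \<le> r * N c" if le: "mult_norm ip X m \<le> r" and rel: "mult_rel m c d" for c d
  proof (cases "N c = 0")
    case True
    then have "comb X c p = 0" if "p \<in> X" for p
      using comb_bound[OF that, of c] by simp
    then have "gram_form X d = 0"
      using rel by (simp add: gram_form_def mult_rel_def)
    then show ?thesis
      using True N_square[of d] by simp
  next
    case False
    then have pos: "N c > 0"
      using N_nonneg[of c] by simp
    let ?a = "of_real (1 / N c) :: complex"
    have 1: "mult_rel m (\<lambda>p. ?a * c p) (\<lambda>p. ?a * d p)"
      using rel by (simp only: mult_rel_def comb_scale) simp
    have sc: "N (\<lambda>p. ?a * g p) = N g / N c" for g
      by (rule trans[OF N_scale]) (use pos in \<open>simp add: norm_divide\<close>)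
    have "N (\<lambda>p. ?a * c p) \<le> 1"
      unfolding sc using pos by simp
    then have "N (\<lambda>p. ?a * d p) \<le> mult_norm ip X m"
      unfolding mult_norm_eq using 1 by (intro cSup_upper[OF _ mult_norm_bdd]) blast
    then have "N d / N c \<le> r"
      using le unfolding sc by simp
    then show ?thesis
      using pos by (simp add: divide_le_eq)
  qed
  moreover have "mult_norm ip X m \<le> r" if *: "\<forall>c d. mult_rel m c d \<longrightarrow> N d \<le> r * N c"
    unfolding mult_norm_eq
  proof (rule cSup_least[OF ne])
    fix x assume "x \<in> ?S"
    then obtain c d where "x = N d" "mult_rel m c d" "N c \<le> 1" by blast
    with * show "x \<le> r"
      using mult_left_mono[OF \<open>N c \<le> 1\<close> r] by force
  qed
  ultimately show ?thesis by blast
qed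

lemma mult_norm_nonneg: "0 \<le> mult_norm ip X m"
proof -
  have "mult_rel m (\<lambda>_. 0) (\<lambda>_. 0)" "N (\<lambda>_. 0) = 0"
    using N_scale[of 0] by (auto simp: mult_rel_def comb_def)
  then have "0 \<in> {N d | c d. mult_rel m c d \<and> N c \<le> 1}"
    by force
  then show ?thesis
    unfolding mult_norm_eq by (rule cSup_upper[OF _ mult_norm_bdd])
qed

text \<open>The adjoint of multiplication by \<open>m\<close> maps the kernel at \<open>p\<close> to \<open>cnj (m p)\<close> times itself.\<close>

lemma ip_mult_rel:
  assumes "mult_rel m c d"
  shows "ip (comb X d) (comb X a) = ip (comb X c) (comb X (\<lambda>p. cnj (m p) * a p))"
  using assms by (simp add: ip_comb_right[OF comb_mem] mult_rel_def mult_ac)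

text \<open>An operator T is contractive iff its adjoint T* is, and T* is diagonal in the kernel
  functions. In one direction the squared norm of T*c is <TT*c, c>, hence at most the product of the
  norms of T*c and c; the other direction exchanges T and T*.\<close>

lemma contractive_iff:
  "mult_norm ip X m \<le> 1 \<longleftrightarrow> (\<forall>c. gram_form X (\<lambda>p. cnj (m p) * c p) \<le> gram_form X c)"
proof
  assume "mult_norm ip X m \<le> 1"
  then have le: "N d \<le> N c" if "mult_rel m c d" for c d
    using that mult_norm_le_iff[of 1 m] by simp
  show "\<forall>c. gram_form X (\<lambda>p. cnj (m p) * c p) \<le> gram_form X c"
  proof
    fix c
    let ?c = "\<lambda>p. cnj (m p) * c p"
    obtain d where d: "mult_rel m ?c d"
      using interpolate[of "\<lambda>p. m p * comb X ?c p"] by (auto simp: mult_rel_def)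
    have "(N ?c)\<^sup>2 = Re (ip (comb X d) (comb X c))"
      unfolding ip_mult_rel[OF d] using ip_nonneg[OF comb_mem] by (simp add: ip_norm_def)
    also have "\<dots> \<le> N d * N c"
      using complex_Re_le_cmod Cauchy_Schwarz[OF comb_mem comb_mem] order_trans by blast
    also have "\<dots> \<le> N ?c * N c"
      using le[OF d] N_nonneg by (rule mult_right_mono)
    finally have "N ?c \<le> N c"
      using N_nonneg[of ?c] N_nonneg[of c] by (cases "N ?c = 0") (auto simp: power2_eq_square)
    then show "gram_form X ?c \<le> gram_form X c"
      unfolding N_square[symmetric] using N_nonneg by (intro power_mono)
  qed
next
  assume *: "\<forall>c. gram_form X (\<lambda>p. cnj (m p) * c p) \<le> gram_form X c"
  have le: "N (\<lambda>p. cnj (m p) * c p) \<le> N c" for c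
    using * N_nonneg unfolding N_square[symmetric] by (simp add: power2_le_iff_abs_le)
  have "N d \<le> N c" if d: "mult_rel m c d" for c d
  proof -
    have "(N d)\<^sup>2 = Re (ip (comb X c) (comb X (\<lambda>p. cnj (m p) * d p)))"
      unfolding ip_mult_rel[OF d, symmetric] using ip_nonneg[OF comb_mem] by (simp add: ip_norm_def)
    also have "\<dots> \<le> N c * N (\<lambda>p. cnj (m p) * d p)"
      using complex_Re_le_cmod Cauchy_Schwarz[OF comb_mem comb_mem] order_trans by blast
    also have "\<dots> \<le> N c * N d"
      using le N_nonneg by (rule mult_left_mono)
    finally show ?thesis
      using N_nonneg[of d] N_nonneg[of c] by (cases "N d = 0") (auto simp: power2_eq_square)
  qed
  then show "mult_norm ip X m \<le> 1"
    using mult_norm_le_iff[of 1 m] by simp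
qed

lemma mult_norm_scale_le:
  assumes "0 \<le> a"
  shows "mult_norm ip X (\<lambda>z. of_real a * m z) \<le> a * mult_norm ip X m"
proof (cases "a = 0")
  case True
  have "N d \<le> 0 * N c" if "mult_rel (\<lambda>z. of_real a * m z) c d" for c d
  proof -
    have "gram_form X d = 0"
      using that True by (simp add: gram_form_def mult_rel_def)
    then show ?thesis
      using N_square[of d] by simp
  qed
  then show ?thesis
    using True mult_norm_le_iff[of 0] by simp
next
  case False
  then have a: "a > 0" using assms by simp
  have "N d \<le> a * mult_norm ip X m * N c" if "mult_rel (\<lambda>z. of_real a * m z) c d" for c d
  proof -
    have "mult_rel m c (\<lambda>p. of_real (1 / a) * d p)"
      using that a by (simp only: mult_rel_def comb_scale) simp
    then have "N (\<lambda>p. of_real (1 / a) * d p) \<le> mult_norm ip X m * N c"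
      using mult_norm_le_iff[OF mult_norm_nonneg, of m m] by blast
    then show ?thesis
      using a by (simp only: N_scale) (simp add: norm_divide field_simps)
  qed
  then show ?thesis
    using mult_norm_le_iff mult_norm_nonneg assms by simp
qed

lemma mult_norm_scale:
  assumes a: "0 < a"
  shows "mult_norm ip X (\<lambda>z. of_real a * m z) = a * mult_norm ip X m"
proof (rule antisym)
  have "mult_norm ip X m \<le> 1 / a * mult_norm ip X (\<lambda>z. of_real a * m z)"
    using mult_norm_scale_le[of "1 / a" "\<lambda>z. of_real a * m z"] a by simp
  then show "a * mult_norm ip X m \<le> mult_norm ip X (\<lambda>z. of_real a * m z)"
    using a by (simp add: field_simps)
qed (use a mult_norm_scale_le[of a m] in simp)

text \<open>Lets the extremal problem be solved over the whole unit ball of multipliers: a maximiser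
  with positive value has norm one, since otherwise it could be enlarged.\<close>

lemma extremal_mult_eqI:
  assumes m: "m \<in> functions_on X" "mult_norm ip X m \<le> 1" "\<forall>z\<in>Z. m z = 0" and pos: "0 < Re (m p)"
    and max: "\<And>m'. m' \<in> functions_on X \<Longrightarrow> mult_norm ip X m' \<le> 1 \<Longrightarrow> \<forall>z\<in>Z. m' z = 0 \<Longrightarrow> Re (m' p) \<le> Re (m p)"
    and unique: "\<And>m'. m' \<in> functions_on X \<Longrightarrow> mult_norm ip X m' \<le> 1 \<Longrightarrow> \<forall>z\<in>Z. m' z = 0 \<Longrightarrow>
                   Re (m' p) = Re (m p) \<Longrightarrow> m' = m"
  shows "extremal_mult ip X Z p = m" "mult_norm ip X m = 1"
proof -
  show n1: "mult_norm ip X m = 1"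
  proof (rule ccontr)
    assume "mult_norm ip X m \<noteq> 1"
    then have "mult_norm ip X m < 1"
      using m(2) by simp
    \<comment> \<open>Dividing by an intermediate \<open>b\<close> instead of by the norm avoids
      showing first that the norm is nonzero.\<close>
    then obtain b where b: "mult_norm ip X m < b" "b < 1"
      using dense by blast
    then have b0: "0 < b"
      using mult_norm_nonneg[of m] by simp
    let ?m = "\<lambda>z. of_real (1 / b) * m z"
    have "mult_norm ip X ?m \<le> 1"
      using b b0 mult_norm_scale[of "1 / b" m] by simp
    then have "Re (?m p) \<le> Re (m p)"
      using m by (intro max) (auto simp: functions_on_def)
    then have "Re (m p) / b \<le> Re (m p)"
      by simp
    then show False
      using pos b b0 by (simp add: field_simps)
  qed
  let ?A = "{m \<in> Mult X. mult_norm ip X m = 1 \<and> (\<forall>z\<in>Z. m z = 0)}"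
  have "m \<in> ?A \<and> (\<forall>m'\<in>?A. Re (m' p) \<le> Re (m p))"
    using m n1 max by (auto simp: Mult_eq)
  moreover have "m' = m" if "m' \<in> ?A \<and> (\<forall>m''\<in>?A. Re (m'' p) \<le> Re (m' p))" for m'
  proof (rule unique)
    have "Re (m' p) \<le> Re (m p)"
      using that max by (auto simp: Mult_eq)
    moreover have "Re (m p) \<le> Re (m' p)"
      using that m n1 by (auto simp: Mult_eq)
    ultimately show "Re (m' p) = Re (m p)" by simp
  qed (use that in \<open>auto simp: Mult_eq\<close>)
  ultimately show "extremal_mult ip X Z p = m"
    unfolding extremal_mult_def Let_def by (rule the_equality) blast
qed

end

section \<open>Extremal problems for ternary Gram forms\<close>

definition form2 :: "real \<Rightarrow> real \<Rightarrow> complex \<Rightarrow> complex \<Rightarrow> complex \<Rightarrow> real" where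
  "form2 p q b x y = p * (cmod x)\<^sup>2 + q * (cmod y)\<^sup>2 + 2 * Re (b * x * cnj y)"

text \<open>Gram form of kernels with \<open>k\<^sub>1\<^sub>j = 1\<close>, \<open>k\<^sub>2\<^sub>2 = A\<close>, \<open>k\<^sub>3\<^sub>3 = C\<close>,
  \<open>k\<^sub>2\<^sub>3 = B\<close>, the normalisation at \<open>x\<^sub>1 = 0\<close>.\<close>

definition form3 :: "real \<Rightarrow> real \<Rightarrow> complex \<Rightarrow> complex \<Rightarrow> complex \<Rightarrow> complex \<Rightarrow> real" where
  "form3 A C B a1 a2 a3 =
     (cmod a1)\<^sup>2 + A * (cmod a2)\<^sup>2 + C * (cmod a3)\<^sup>2 +
     2 * Re (a1 * cnj a2 + a1 * cnj a3 + B * a2 * cnj a3)"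

text \<open>\<open>contr3\<close> is contractivity of the adjoint of the multiplier with values \<open>m1, m2, m3\<close>.\<close>

definition contr3 :: "real \<Rightarrow> real \<Rightarrow> complex \<Rightarrow> complex \<Rightarrow> complex \<Rightarrow> complex \<Rightarrow> bool" where
  "contr3 A C B m1 m2 m3 \<longleftrightarrow>
     (\<forall>a1 a2 a3. form3 A C B (cnj m1 * a1) (cnj m2 * a2) (cnj m3 * a3) \<le> form3 A C B a1 a2 a3)"

lemma form2_nonneg:
  assumes p: "p > 0" and b: "(cmod b)\<^sup>2 \<le> p * q"
  shows "0 \<le> form2 p q b x y"
proof -
  have "p * form2 p q b x y = (cmod (of_real p * x + cnj b * y))\<^sup>2 + (p * q - (cmod b)\<^sup>2) * (cmod y)\<^sup>2"
    unfolding form2_def cmod_power2 by (simp add: algebra_simps power2_eq_square)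
  then have "0 \<le> p * form2 p q b x y"
    using b by simp
  then show ?thesis
    using p by (simp add: zero_le_mult_iff)
qed

text \<open>This is the source of uniqueness of extremal multipliers: when a diagonal entry
  vanishes, a nonzero \<open>b\<close> would make the form unbounded below.\<close>

lemma form2_nonnegD:
  assumes "\<And>x y. 0 \<le> form2 p q b x y"
  shows "0 \<le> p" and "p = 0 \<Longrightarrow> b = 0"
proof -
  show "0 \<le> p"
    using assms[of 1 0] by (simp add: form2_def)
  assume p: "p = 0"
  show "b = 0"
  proof (rule ccontr)
    assume "b \<noteq> 0"
    have "form2 p q b (- (of_real t * cnj b)) 1 = q - 2 * (t * (cmod b)\<^sup>2)" for t
      unfolding p form2_def cmod_power2 by (simp add: power2_eq_square algebra_simps)
    then have "0 \<le> q - 2 * (t * (cmod b)\<^sup>2)" for t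
      using assms by metis
    \<comment> \<open>With this t the right-hand side is \<open>q - (\<bar>q\<bar> + 1)\<close>,
      which is negative.\<close>
    from this[of "(\<bar>q\<bar> + 1) / (2 * (cmod b)\<^sup>2)"] show False
      using \<open>b \<noteq> 0\<close> by simp
  qed
qed

lemma form2_scale:
  "form2 p q b (cnj m * x) (cnj n * y) = form2 (p * (cmod m)\<^sup>2) (q * (cmod n)\<^sup>2) (b * cnj m * n) x y"
  by (simp add: form2_def norm_mult power_mult_distrib mult_ac)

lemma form2_diff: "form2 p q b x y - form2 p' q' b' x y = form2 (p - p') (q - q') (b - b') x y"
  by (simp add: form2_def algebra_simps)

lemma form3_swap: "form3 A C B a1 a2 a3 = form3 C A (cnj B) a1 a3 a2"
  by (simp add: form3_def algebra_simps)

lemma contr3_swap: "contr3 A C B m1 m2 m3 \<longleftrightarrow> contr3 C A (cnj B) m1 m3 m2"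
  unfolding contr3_def by (subst (1 2) form3_swap) blast

text \<open>With \<open>m1 = 0\<close> the image under the adjoint does not involve
  \<open>a1\<close>. Completing the square in \<open>a1\<close> leaves a binary form, which is the
  exact difference at the minimiser \<open>a1 = - (a2 + a3)\<close>.\<close>

lemma contr3_zero_first:
  "contr3 A C B 0 m2 m3 \<longleftrightarrow>
     (\<forall>x y. 0 \<le> form2 (A - 1 - A * (cmod m2)\<^sup>2) (C - 1 - C * (cmod m3)\<^sup>2) (B - 1 - B * cnj m2 * m3) x y)"
proof -
  have "form3 A C B a1 a2 a3 - form3 A C B (cnj 0 * a1) (cnj m2 * a2) (cnj m3 * a3) = (cmod (a1 + a2 + a3))\<^sup>2
      + form2 (A - 1 - A * (cmod m2)\<^sup>2) (C - 1 - C * (cmod m3)\<^sup>2) (B - 1 - B * cnj m2 * m3) a2 a3"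
    for a1 a2 a3
  proof -
    have "form3 A C B a1 a2 a3 = (cmod (a1 + a2 + a3))\<^sup>2 + form2 (A - 1) (C - 1) (B - 1) a2 a3"
      unfolding form2_def form3_def cmod_power2 by (simp add: algebra_simps power2_eq_square)
    moreover have "form3 A C B (cnj 0 * a1) x y = form2 A C B x y" for x y
      by (simp add: form2_def form3_def)
    ultimately show ?thesis
      by (simp add: form2_scale flip: form2_diff)
  qed
  note eq = this
  have "0 \<le> form2 (A - 1 - A * (cmod m2)\<^sup>2) (C - 1 - C * (cmod m3)\<^sup>2) (B - 1 - B * cnj m2 * m3) x y"
    if "contr3 A C B 0 m2 m3" for x y
    using eq[of "- (x + y)" x y] that[unfolded contr3_def, rule_format, of "- (x + y)" x y] by simp
  moreover have "contr3 A C B 0 m2 m3"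
    if "\<forall>x y. 0 \<le> form2 (A - 1 - A * (cmod m2)\<^sup>2) (C - 1 - C * (cmod m3)\<^sup>2) (B - 1 - B * cnj m2 * m3) x y"
    unfolding contr3_def
  proof (intro allI)
    fix a1 a2 a3
    show "form3 A C B (cnj 0 * a1) (cnj m2 * a2) (cnj m3 * a3) \<le> form3 A C B a1 a2 a3"
      using eq[of a1 a2 a3] that[rule_format, of a2 a3] by (smt (verit) zero_le_power2)
  qed
  ultimately show ?thesis by blast
qed

text \<open>The same elimination, now of \<open>a2\<close>; the entries free of multiplier values
  are those of the Schur complement of \<open>A\<close> in the Gram matrix.\<close>

lemma contr3_zero_second:
  assumes A: "A > 0"
  shows "contr3 A C B m1 0 m3 \<longleftrightarrow>
     (\<forall>x y. 0 \<le> form2 (1 - 1 / A - (cmod m1)\<^sup>2) (C - (cmod B)\<^sup>2 / A - C * (cmod m3)\<^sup>2)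
                   (1 - B / of_real A - cnj m1 * m3) x y)"
    (is "_ \<longleftrightarrow> (\<forall>x y. 0 \<le> ?F x y)")
proof -
  have eq: "form3 A C B a1 a2 a3 - form3 A C B (cnj m1 * a1) (cnj 0 * a2) (cnj m3 * a3) =
      A * (cmod (a2 + (a1 + cnj B * a3) / of_real A))\<^sup>2 + ?F a1 a3" for a1 a2 a3
  proof -
    have "form3 A C B a1 (z - (a1 + cnj B * a3) / of_real A) a3 = A * (cmod z)\<^sup>2
        + form2 (1 - 1 / A) (C - (cmod B)\<^sup>2 / A) (1 - B / of_real A) a1 a3" for z
      unfolding form2_def form3_def cmod_power2 using A
      by (simp add: field_simps power2_eq_square)
    from this[of "a2 + (a1 + cnj B * a3) / of_real A"]
    have "form3 A C B a1 a2 a3 = A * (cmod (a2 + (a1 + cnj B * a3) / of_real A))\<^sup>2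
        + form2 (1 - 1 / A) (C - (cmod B)\<^sup>2 / A) (1 - B / of_real A) a1 a3"
      by simp
    moreover have "form3 A C B x (cnj 0 * a2) y = form2 1 C 1 x y" for x y
      by (simp add: form2_def form3_def)
    ultimately show ?thesis
      by (simp add: form2_scale flip: form2_diff)
  qed
  have "0 \<le> ?F x y" if "contr3 A C B m1 0 m3" for x y
    using eq[of x "- ((x + cnj B * y) / of_real A)" y]
      that[unfolded contr3_def, rule_format, of x "- ((x + cnj B * y) / of_real A)" y] by simp
  moreover have "contr3 A C B m1 0 m3" if "\<forall>x y. 0 \<le> ?F x y"
    unfolding contr3_def
  proof (intro allI)
    fix a1 a2 a3
    have "0 \<le> A * (cmod (a2 + (a1 + cnj B * a3) / of_real A))\<^sup>2"
      using A by simp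
    then show "form3 A C B (cnj m1 * a1) (cnj 0 * a2) (cnj m3 * a3) \<le> form3 A C B a1 a2 a3"
      using eq[of a1 a2 a3] that[rule_format, of a1 a3] by linarith
  qed
  ultimately show ?thesis by blast
qed

text \<open>Schur complement of the entry \<open>k\<^sub>1\<^sub>1 = 1\<close> in the Gram matrix.\<close>

definition schur :: "real \<Rightarrow> real \<Rightarrow> complex \<Rightarrow> real" where
  "schur A C B = ((A - 1) * (C - 1) - (cmod (B - 1))\<^sup>2) / (A * C - (cmod B)\<^sup>2)"

text \<open>For fixed \<open>a1\<close> the minimum of \<open>form3\<close> over \<open>a2\<close>
  and \<open>a3\<close> is \<open>schur A C B * (cmod a1)\<^sup>2\<close>, and the adjoint side
  depends on \<open>a1\<close> only.\<close>

lemma contr3_zero_both: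
  assumes A: "A > 0" and d: "A * C > (cmod B)\<^sup>2"
  shows "contr3 A C B m1 0 0 \<longleftrightarrow> (cmod m1)\<^sup>2 \<le> schur A C B"
proof -
  define d where "d = A * C - (cmod B)\<^sup>2"
  have d: "d > 0" using d by (simp add: d_def)
  \<comment> \<open>\<open>x0\<close> and \<open>y0\<close> give the minimising \<open>a2\<close>
    and \<open>a3\<close>, by Cramer's rule for the stationarity equations verified below.\<close>
  define x0 where "x0 a = - (a * (of_real C - cnj B) / of_real d)" for a
  define y0 where "y0 a = - (a * (of_real A - B) / of_real d)" for a
  have "form3 A C B a1 a2 a3 = form2 A C B (a2 - x0 a1) (a3 - y0 a1) + schur A C B * (cmod a1)\<^sup>2" for a1 a2 a3
  proof -
    have d_eq: "of_real A * of_real C = of_real d + B * cnj B"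
      by (simp add: d_def flip: complex_norm_square)
    have 1: "of_real A * x0 a1 + cnj B * y0 a1 + a1 = 0" "of_real C * y0 a1 + B * x0 a1 + a1 = 0"
      using d by (simp_all add: x0_def y0_def field_simps) (simp_all add: d_eq algebra_simps)
    \<comment> \<open>Expansion about (x, y): the last two terms contain the stationarity
      expressions as factors and vanish at \<open>x0 a1\<close>, \<open>y0 a1\<close>.\<close>
    have "form3 A C B a1 (x + p) (y + q) = form2 A C B p q + (cmod a1)\<^sup>2 + Re (cnj a1 * (x + y))
        + Re ((2 * cnj p + cnj x) * (of_real A * x + cnj B * y + a1))
        + Re ((2 * cnj q + cnj y) * (of_real C * y + B * x + a1))" for x y p q
      unfolding form2_def form3_def cmod_power2 by (simp add: power2_eq_square algebra_simps)
    from this[of "x0 a1" "a2 - x0 a1" "y0 a1" "a3 - y0 a1"]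
    have "form3 A C B a1 a2 a3 = form2 A C B (a2 - x0 a1) (a3 - y0 a1)
        + (cmod a1)\<^sup>2 + Re (cnj a1 * (x0 a1 + y0 a1))"
      by (simp add: 1)
    moreover have "(cmod a1)\<^sup>2 + Re (cnj a1 * (x0 a1 + y0 a1)) = schur A C B * (cmod a1)\<^sup>2"
    proof -
      have "cnj a1 * (x0 a1 + y0 a1) = of_real ((cmod a1)\<^sup>2) * (- (of_real (A + C) - (B + cnj B)) / of_real d)"
        unfolding complex_norm_square x0_def y0_def using d by (simp add: field_simps)
      also have "\<dots> = of_real ((cmod a1)\<^sup>2 * (- (A + C - 2 * Re B) / d))"
        by (simp add: complex_add_cnj)
      finally have re: "Re (cnj a1 * (x0 a1 + y0 a1)) = (cmod a1)\<^sup>2 * (- (A + C - 2 * Re B) / d)"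
        by (simp only: Re_complex_of_real)
      have sch: "schur A C B = (d - (A + C - 2 * Re B)) / d"
        unfolding schur_def d_def cmod_power2 by (simp add: power2_eq_square algebra_simps)
      show ?thesis
        unfolding re sch using d by (simp add: field_simps)
    qed
    ultimately show ?thesis by simp
  qed
  note eq = this
  have one: "form3 A C B (cnj m1 * a1) (cnj 0 * a2) (cnj 0 * a3) = (cmod m1)\<^sup>2 * (cmod a1)\<^sup>2" for a1 a2 a3
    by (simp add: form3_def norm_mult power_mult_distrib)
  show ?thesis
  proof
    assume "contr3 A C B m1 0 0"
    then have "form3 A C B (cnj m1 * 1) (cnj 0 * x0 1) (cnj 0 * y0 1) \<le> form3 A C B 1 (x0 1) (y0 1)"
      unfolding contr3_def by blast
    then show "(cmod m1)\<^sup>2 \<le> schur A C B"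
      unfolding one unfolding eq by (simp add: form2_def)
  next
    assume le: "(cmod m1)\<^sup>2 \<le> schur A C B"
    show "contr3 A C B m1 0 0"
      unfolding contr3_def one unfolding eq
      using form2_nonneg[OF A, of B C] d mult_right_mono[OF le]
      by (smt (verit) d_def zero_le_power2)
  qed
qed

text \<open>A maximal real part leaves no room for an imaginary part; this passes from equality of
  real parts to equality of values in the uniqueness proofs.\<close>

lemma eq_of_Re_eq_sqrt:
  assumes "(cmod z)\<^sup>2 \<le> S" "Re z = sqrt S"
  shows "z = of_real (sqrt S)"
proof -
  have "S \<ge> 0" using assms(1) order_trans zero_le_power2 by blast
  then have "(Im z)\<^sup>2 \<le> 0"
    using assms by (simp add: cmod_power2)
  then show ?thesis
    using assms(2) by (simp add: complex_eq_iff)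
qed

lemma Re_le_sqrt: "(cmod z)\<^sup>2 \<le> S \<Longrightarrow> Re z \<le> sqrt S"
  using complex_Re_le_cmod[of z] real_le_rsqrt order_trans by blast

text \<open>Here \<open>S = |x\<^sub>2|\<^sup>2\<close>, \<open>R = |x\<^sub>3|\<^sup>2\<close>, \<open>u = \<langle>x\<^sub>3, x\<^sub>2\<rangle>\<close>; \<open>sep\<close> says that \<open>x\<^sub>2\<close> and \<open>x\<^sub>3\<close> are distinct.
  The hypotheses are symmetric under exchanging the two points.\<close>

locale triple_data =
  fixes S R :: real and u :: complex
  assumes S: "0 < S" "S < 1" and R: "0 < R" "R < 1" and uSR: "(cmod u)\<^sup>2 \<le> S * R"
    and sep: "(1 - S) * (1 - R) < (cmod (1 - u))\<^sup>2"
begin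

definition "A = inverse (1 - S)"
definition "C = inverse (1 - R)"
definition "B = inverse (1 - u)"

lemma u1: "1 - u \<noteq> 0"
proof
  assume "1 - u = 0"
  then have "(1 - S) * (1 - R) < 0"
    using sep by simp
  moreover have "0 < (1 - S) * (1 - R)"
    using S R by (intro mult_pos_pos) auto
  ultimately show False by simp
qed

lemma swap: "triple_data R S (cnj u)"
proof
  have "cmod (1 - cnj u) = cmod (1 - u)"
    by (metis complex_cnj_diff complex_cnj_one complex_mod_cnj)
  then show "(1 - R) * (1 - S) < (cmod (1 - cnj u))\<^sup>2"
    using sep by (simp add: mult.commute)
qed (use S R uSR in \<open>auto simp: mult.commute\<close>)

lemma AC: "A > 0" "C > 0" "A - 1 = S * A" "C - 1 = R * C" "B - 1 = u * B" "B \<noteq> 0"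
  using S R u1 by (auto simp: A_def C_def B_def field_simps)

lemma gap: "(cmod B)\<^sup>2 < A * C"
proof -
  have "(cmod B)\<^sup>2 = inverse ((cmod (1 - u))\<^sup>2)"
    by (simp add: B_def norm_inverse power_inverse)
  also have "\<dots> < inverse ((1 - S) * (1 - R))"
    using sep S R by (intro less_imp_inverse_less) auto
  finally show ?thesis
    by (simp add: A_def C_def inverse_mult_distrib)
qed

text \<open>The first diagonal entry of the binary form is
  \<open>A * (S - (cmod m2)\<^sup>2)\<close>. At the extremal value it vanishes, so the off-diagonal
  entry \<open>B * (u - of_real (sqrt S) * m3)\<close> does too.\<close>

lemma zero_first:
  assumes "contr3 A C B 0 m2 m3"
  shows "(cmod m2)\<^sup>2 \<le> S" and "m2 = of_real (sqrt S) \<Longrightarrow> m3 = u / of_real (sqrt S)"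
proof -
  note D = form2_nonnegD[OF assms[unfolded contr3_zero_first, rule_format]]
  have "0 \<le> A * (S - (cmod m2)\<^sup>2)"
    using D(1) AC(3) by (simp add: algebra_simps)
  then show "(cmod m2)\<^sup>2 \<le> S"
    using AC(1) by (simp add: zero_le_mult_iff)
  assume m2: "m2 = of_real (sqrt S)"
  then have "A - 1 - A * (cmod m2)\<^sup>2 = 0"
    using S AC(3) by simp
  then have "B - 1 - B * cnj m2 * m3 = 0"
    by (rule D(2))
  then have "B * (u - of_real (sqrt S) * m3) = 0"
    using AC(5) m2 by (simp add: algebra_simps)
  then show "m3 = u / of_real (sqrt S)"
    using AC(6) S by (simp add: field_simps)
qed

text \<open>Only the second diagonal entry survives; its sign is that of
  \<open>S * R - (cmod u)\<^sup>2\<close>.\<close>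

lemma zero_first_extremal: "contr3 A C B 0 (of_real (sqrt S)) (u / of_real (sqrt S))"
proof -
  have 1: "A - 1 - A * (cmod (of_real (sqrt S)))\<^sup>2 = 0"
    using S AC(3) by simp
  have 2: "B - 1 - B * cnj (of_real (sqrt S)) * (u / of_real (sqrt S)) = 0"
    using AC(5) S by simp
  have "(cmod u)\<^sup>2 / S \<le> R"
    using uSR S by (simp add: field_simps)
  then have "C * ((cmod u)\<^sup>2 / S) \<le> C * R"
    using AC(2) by (intro mult_left_mono) auto
  then have "0 \<le> C - 1 - C * (cmod (u / of_real (sqrt S)))\<^sup>2"
    using AC(4) S by (simp add: norm_divide power_divide mult.commute)
  then show ?thesis
    unfolding contr3_zero_first 1 2 by (simp add: form2_def)
qed

lemma Schur_complement_entries: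
  "1 - 1 / A = S" "1 - B / of_real A = (of_real S - u) / (1 - u)"
  using S u1 by (auto simp: A_def B_def field_simps)

lemma zero_second:
  assumes "contr3 A C B m1 0 m3"
  shows "(cmod m1)\<^sup>2 \<le> S"
    and "m1 = of_real (sqrt S) \<Longrightarrow> m3 = (of_real S - u) / (of_real (sqrt S) * (1 - u))"
proof -
  note D = form2_nonnegD[OF assms[unfolded contr3_zero_second[OF AC(1)] Schur_complement_entries, rule_format]]
  show "(cmod m1)\<^sup>2 \<le> S"
    using D(1) by simp
  assume m1: "m1 = of_real (sqrt S)"
  then have "S - (cmod m1)\<^sup>2 = 0"
    using S by simp
  then have "(of_real S - u) / (1 - u) - cnj m1 * m3 = 0"
    by (rule D(2))
  then have "of_real (sqrt S) * m3 = (of_real S - u) / (1 - u)"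
    using m1 by simp
  then show "m3 = (of_real S - u) / (of_real (sqrt S) * (1 - u))"
    using S u1 by (simp add: field_simps)
qed

lemma zero_second_extremal:
  "contr3 A C B (of_real (sqrt S)) 0 ((of_real S - u) / (of_real (sqrt S) * (1 - u)))"
    (is "contr3 A C B _ 0 ?m")
proof -
  have 1: "S - (cmod (of_real (sqrt S)))\<^sup>2 = 0"
    using S by simp
  have 2: "(of_real S - u) / (1 - u) - cnj (of_real (sqrt S)) * ?m = 0"
    using S by simp
  have "0 \<le> C - (cmod B)\<^sup>2 / A - C * (cmod ?m)\<^sup>2"
  proof -
    define n where "n = (cmod (1 - u))\<^sup>2"
    have n: "n > 0" using u1 by (simp add: n_def)
    have m: "(cmod ?m)\<^sup>2 = (cmod (of_real S - u))\<^sup>2 / (S * n)"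
      using S by (simp add: norm_divide norm_mult power_divide power_mult_distrib n_def)
    have B: "(cmod B)\<^sup>2 = 1 / n"
      by (simp add: B_def norm_inverse power_inverse n_def divide_inverse)
    have "C - (cmod B)\<^sup>2 / A - C * (cmod ?m)\<^sup>2
        = (S * n - S * (1 - S) * (1 - R) - (cmod (of_real S - u))\<^sup>2) / (S * n * (1 - R))"
    proof -
      \<comment> \<open>Clearing denominators with \<open>1 - R\<close>, \<open>1 - S\<close> and
        \<open>(cmod (of_real S - u))\<^sup>2\<close> as opaque r, s, k.\<close>
      have "inverse r - 1 / n / inverse s - inverse r * (k / (S * n)) = (S * n - S * s * r - k) / (S * n * r)"
        if "r > 0" "s > 0" for r s k :: real
        using that S n by (simp add: field_simps)
      then show ?thesis
        unfolding m B A_def C_def using S R by simp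
    qed
    \<comment> \<open>The surviving entry is again a positive multiple of the Cauchy-Schwarz defect
      \<open>S * R - (cmod u)\<^sup>2\<close>.\<close>
    also have "S * n - S * (1 - S) * (1 - R) - (cmod (of_real S - u))\<^sup>2 = (1 - S) * (S * R - (cmod u)\<^sup>2)"
      unfolding n_def cmod_power2 by (simp add: algebra_simps power2_eq_square)
    finally show ?thesis
      using S R n uSR by simp
  qed
  then show ?thesis
    unfolding contr3_zero_second[OF AC(1)] Schur_complement_entries 1 2 by (simp add: form2_def)
qed

text \<open>Subtracting \<open>S * R * (A * C - (cmod B)\<^sup>2)\<close> leaves
  \<open>(S * R - (cmod u)\<^sup>2) * (cmod B)\<^sup>2\<close>, which is how the Schur complement is
  compared with \<open>S * R\<close>.\<close>

lemma schur_formula: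
  "schur A C B * (A * C - (cmod B)\<^sup>2) = S * R * (A * C) - (cmod u)\<^sup>2 * (cmod B)\<^sup>2"
proof -
  have "schur A C B * (A * C - (cmod B)\<^sup>2) = (A - 1) * (C - 1) - (cmod (B - 1))\<^sup>2"
    using gap by (simp add: schur_def)
  then show ?thesis
    by (simp only: AC(3-5) norm_mult power_mult_distrib mult_ac)
qed

lemma schur_pos: "0 < schur A C B"
proof -
  have "(cmod u)\<^sup>2 * (cmod B)\<^sup>2 \<le> S * R * (cmod B)\<^sup>2"
    using uSR by (intro mult_right_mono) auto
  also have "\<dots> < S * R * (A * C)"
    using gap S R by simp
  finally have "0 < schur A C B * (A * C - (cmod B)\<^sup>2)"
    unfolding schur_formula by simp
  then show ?thesis
    using gap by (simp add: zero_less_mult_iff)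
qed

lemma schur_eq_iff: "schur A C B = S * R \<longleftrightarrow> (cmod u)\<^sup>2 = S * R"
proof -
  have "schur A C B = S * R \<longleftrightarrow>
      schur A C B * (A * C - (cmod B)\<^sup>2) = S * R * (A * C - (cmod B)\<^sup>2)"
    using gap by simp
  also have "\<dots> \<longleftrightarrow> (cmod u)\<^sup>2 * (cmod B)\<^sup>2 = S * R * (cmod B)\<^sup>2"
    unfolding schur_formula by (auto simp: algebra_simps)
  also have "\<dots> \<longleftrightarrow> (cmod u)\<^sup>2 = S * R"
    using AC(6) by simp
  finally show ?thesis .
qed

lemmas zero_both = contr3_zero_both[OF AC(1) gap]

end

section \<open>Transfer to the third point by exchanging the second and third points\<close>

context triple_data
begin

interpretation sw: triple_data R S "cnj u"
  by (rule swap)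

lemma swapped_coefficients: "sw.A = C" "sw.C = A" "sw.B = cnj B"
  by (simp_all add: A_def C_def B_def sw.A_def sw.C_def sw.B_def)

lemma zero_first_swapped:
  assumes "contr3 A C B 0 m2 m3"
  shows "(cmod m3)\<^sup>2 \<le> R" and "m3 = of_real (sqrt R) \<Longrightarrow> m2 = cnj u / of_real (sqrt R)"
  using sw.zero_first[unfolded swapped_coefficients, OF assms[unfolded contr3_swap[of A]]] by blast+

lemma zero_first_extremal_swapped: "contr3 A C B 0 (cnj u / of_real (sqrt R)) (of_real (sqrt R))"
  using sw.zero_first_extremal unfolding swapped_coefficients contr3_swap[of A] .

lemma zero_third:
  assumes "contr3 A C B m1 m2 0"
  shows "(cmod m1)\<^sup>2 \<le> R"
    and "m1 = of_real (sqrt R) \<Longrightarrow> m2 = (of_real R - cnj u) / (of_real (sqrt R) * (1 - cnj u))"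
  using sw.zero_second[unfolded swapped_coefficients, OF assms[unfolded contr3_swap[of A]]] by blast+

lemma zero_third_extremal:
  "contr3 A C B (of_real (sqrt R)) ((of_real R - cnj u) / (of_real (sqrt R) * (1 - cnj u))) 0"
  using sw.zero_second_extremal unfolding swapped_coefficients contr3_swap[of A] .

end

section \<open>Normal triples in the Drury--Arveson space\<close>

(* otherwise simp turns x 1 into x (Suc 0) *)
declare One_nat_def [simp del]

lemma hinner_2: "hinner (v :: complex ^ 2) z = v $ 1 * cnj (z $ 1) + v $ 2 * cnj (z $ 2)"
  by (simp add: hinner_def sum_2)

lemma norm_sq_2: "(norm (v :: complex ^ 2))\<^sup>2 = (cmod (v $ 1))\<^sup>2 + (cmod (v $ 2))\<^sup>2"
  by (simp add: norm_vec_def L2_set_def sum_2)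

text \<open>Cramer's rule.\<close>

lemma two_by_two_solution:
  fixes p q b b' :: complex
  assumes "p * q - b * b' \<noteq> 0"
  shows "\<exists>x y. p * x + b * y = g \<and> b' * x + q * y = h"
proof (intro exI conjI)
  let ?e = "p * q - b * b'"
  have "(p * (q * g - b * h) + b * (p * h - b' * g)) / ?e = g"
    using assms by (simp add: divide_eq_eq algebra_simps)
  then show "p * ((q * g - b * h) / ?e) + b * ((p * h - b' * g) / ?e) = g"
    by (simp only: add_divide_distrib times_divide_eq_right)
  have "(b' * (q * g - b * h) + q * (p * h - b' * g)) / ?e = h"
    using assms by (simp add: divide_eq_eq algebra_simps)
  then show "b' * ((q * g - b * h) / ?e) + q * ((p * h - b' * g) / ?e) = h"
    by (simp only: add_divide_distrib times_divide_eq_right)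
qed

locale normal_da =
  fixes DA2 :: "(complex ^ 2 \<Rightarrow> complex) set" and ip :: "(complex ^ 2) ip"
    and x :: "nat \<Rightarrow> complex ^ 2" and s :: real and w :: complex and t :: real
  assumes nt: "normal_triple s w t x" and da2: "drury_arveson_2 DA2 ip"
begin

abbreviation "S \<equiv> s\<^sup>2"
abbreviation "R \<equiv> (cmod w)\<^sup>2 + t\<^sup>2"
abbreviation "u \<equiv> w * complex_of_real s"

lemma s_pos: "s > 0"
  using nt by (simp add: normal_triple_def)

lemma in_ball: "norm (x 1) < 1" "norm (x 2) < 1" "norm (x 3) < 1"
  using nt by (auto simp: normal_triple_def)

lemma distinct: "x 1 \<noteq> x 2" "x 1 \<noteq> x 3" "x 2 \<noteq> x 3"
  using nt by (auto simp: normal_triple_def inj_on_def)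

lemmas coords = normal_triple_coordinates[OF nt]

lemma triple_data: "triple_data S R u"
proof
  show "0 < S" using s_pos by simp
  have "S = (norm (x 2))\<^sup>2"
    using s_pos by (simp add: norm_sq_2 coords)
  then show "S < 1"
    using in_ball(2) by (simp add: power_less_one_iff)
  have R: "R = (norm (x 3))\<^sup>2"
    by (simp add: norm_sq_2 coords)
  have "x 1 = 0"
    by (simp add: vec_eq_iff forall_2 coords)
  then show "0 < R"
    unfolding R using distinct(2) by simp
  show "R < 1"
    unfolding R using in_ball(3) by (simp add: power_less_one_iff)
  show "(cmod u)\<^sup>2 \<le> S * R"
    by (simp add: norm_mult power_mult_distrib algebra_simps)
  \<comment> \<open>This identity turns distinctness of \<open>x 2\<close> and \<open>x 3\<close>
    into the strict inequality: the right side vanishes only if w = s and t = 0.\<close>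
  have "(cmod (1 - u))\<^sup>2 - (1 - S) * (1 - R) = (cmod (of_real s - w))\<^sup>2 + t\<^sup>2 * (1 - S)"
    unfolding cmod_power2 by (simp add: algebra_simps power2_eq_square)
  moreover have "0 < (cmod (of_real s - w))\<^sup>2 + t\<^sup>2 * (1 - S)"
  proof (cases "of_real s = w")
    case True
    then have "t \<noteq> 0"
      using distinct(3) by (auto simp: vec_eq_iff forall_2 coords)
    then show ?thesis
      using \<open>S < 1\<close> True by simp
  next
    case False
    then show ?thesis
      using \<open>S < 1\<close> by (simp add: add_pos_nonneg)
  qed
  ultimately show "(1 - S) * (1 - R) < (cmod (1 - u))\<^sup>2"
    by linarith
qed

end

sublocale normal_da \<subseteq> triple_data "s\<^sup>2" "(cmod w)\<^sup>2 + t\<^sup>2" "w * complex_of_real s"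
  by (rule triple_data)

context normal_da
begin

lemma kernel_values:
  "da_kernel (x 1) (x 1) = 1" "da_kernel (x 1) (x 2) = 1" "da_kernel (x 1) (x 3) = 1"
  "da_kernel (x 2) (x 1) = 1" "da_kernel (x 2) (x 2) = of_real A" "da_kernel (x 2) (x 3) = B"
  "da_kernel (x 3) (x 1) = 1" "da_kernel (x 3) (x 2) = cnj B" "da_kernel (x 3) (x 3) = of_real C"
proof -
  have "complex_of_real (cmod w) * complex_of_real (cmod w) = w * cnj w"
    using complex_norm_square[of w] by (simp add: power2_eq_square)
  then show
    "da_kernel (x 1) (x 1) = 1" "da_kernel (x 1) (x 2) = 1" "da_kernel (x 1) (x 3) = 1"
    "da_kernel (x 2) (x 1) = 1" "da_kernel (x 2) (x 2) = of_real A" "da_kernel (x 2) (x 3) = B"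
    "da_kernel (x 3) (x 1) = 1" "da_kernel (x 3) (x 2) = cnj B" "da_kernel (x 3) (x 3) = of_real C"
    unfolding A_def B_def C_def unfolding power2_eq_square using in_ball
    by (simp_all add: da_kernel_def hinner_2 coords mult.commute)
qed

lemma sum_points: "(\<Sum>p\<in>points x. f p) = f (x 1) + f (x 2) + f (x 3)"
  using distinct by (simp add: add.assoc)

text \<open>Subtracting the equation at \<open>x 1\<close>, where all kernels are 1, from the other
  two leaves a system for the last two coefficients. Its determinant is the numerator of
  \<open>schur\<close>, nonzero by \<open>schur_pos\<close>.\<close>

lemma full: "functions_on (points x) \<subseteq> DA2X (points x)"
proof
  fix f assume f: "f \<in> functions_on (points x)"
  have "(of_real A - 1) * (of_real C - 1) - (cnj B - 1) * (B - 1)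
      = complex_of_real ((A - 1) * (C - 1) - (cmod (B - 1))\<^sup>2)"
    by (simp only: of_real_diff of_real_mult complex_norm_square) (simp add: mult.commute)
  moreover have "(A - 1) * (C - 1) - (cmod (B - 1))\<^sup>2 \<noteq> 0"
    using schur_pos by (auto simp: schur_def)
  ultimately have "(of_real A - 1) * (of_real C - 1) - (cnj B - 1) * (B - 1) \<noteq> 0"
    by (simp only: of_real_eq_0_iff not_False_eq_True)
  from two_by_two_solution[OF this] obtain a2 a3 where
    a: "(of_real A - 1) * a2 + (cnj B - 1) * a3 = f (x 2) - f (x 1)"
       "(B - 1) * a2 + (of_real C - 1) * a3 = f (x 3) - f (x 1)"
    by blast
  define c where "c p = (if p = x 1 then f (x 1) - a2 - a3 else if p = x 2 then a2 else a3)" for p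
  have c: "c (x 1) = f (x 1) - a2 - a3" "c (x 2) = a2" "c (x 3) = a3"
    using distinct by (auto simp: c_def)
  have "comb (points x) c (x i) = f (x i)" if "i \<in> {1,2,3}" for i
    using that a unfolding comb_def sum_points by (auto simp: c kernel_values algebra_simps)
  then have "f = restr (points x) (comb (points x) c)"
    using f by (auto simp: restr_def functions_on_def fun_eq_iff)
  then show "f \<in> DA2X (points x)"
    by (auto simp: DA2X_def kernel_span_eq)
qed

end

sublocale normal_da \<subseteq> da_points DA2 ip "points x"
  using da2 full in_ball by unfold_locales auto

(* keeps points x folded *)
declare image_insert [simp del]

context normal_da
begin

section \<open>The extremal multipliers and Delta of a normal triple\<close>

definition tri :: "complex \<Rightarrow> complex \<Rightarrow> complex \<Rightarrow> complex ^ 2 \<Rightarrow> complex" where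
  "tri a b c = (\<lambda>p. if p = x 1 then a else if p = x 2 then b else if p = x 3 then c else 0)"

lemma tri_simps [simp]: "tri a b c (x 1) = a" "tri a b c (x 2) = b" "tri a b c (x 3) = c"
  using distinct by (auto simp: tri_def)

lemma tri_mem [simp]: "tri a b c \<in> functions_on (points x)"
  by (auto simp: tri_def functions_on_def image_insert)

lemma tri_eqI: "m \<in> functions_on (points x) \<Longrightarrow> m (x 1) = a \<Longrightarrow> m (x 2) = b \<Longrightarrow> m (x 3) = c \<Longrightarrow> m = tri a b c"
  by (auto simp: tri_def functions_on_def image_insert)

lemma tri_mult: "(\<lambda>z. tri a b c z * tri a' b' c' z) = tri (a * a') (b * b') (c * c')"
  by (auto simp: tri_def)

lemma tri_scale: "(\<lambda>z. k * tri a b c z) = tri (k * a) (k * b) (k * c)"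
  by (auto simp: tri_def)

lemma tri_eq_iff: "tri a b c = tri a' b' c' \<longleftrightarrow> a = a' \<and> b = b' \<and> c = c'"
  by (metis tri_simps)

lemma gram_form_eq: "gram_form (points x) c = form3 A C B (c (x 1)) (c (x 2)) (c (x 3))"
  unfolding gram_form_def comb_def sum_points kernel_values form3_def cmod_power2
  by (simp add: algebra_simps power2_eq_square)

lemma mult_norm_le_1_iff:
  "mult_norm ip (points x) m \<le> 1 \<longleftrightarrow> contr3 A C B (m (x 1)) (m (x 2)) (m (x 3))"
proof
  assume "mult_norm ip (points x) m \<le> 1"
  then have *: "gram_form (points x) (\<lambda>p. cnj (m p) * c p) \<le> gram_form (points x) c" for c
    using contractive_iff by blast
  show "contr3 A C B (m (x 1)) (m (x 2)) (m (x 3))"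
    unfolding contr3_def
  proof (intro allI)
    fix a1 a2 a3
    show "form3 A C B (cnj (m (x 1)) * a1) (cnj (m (x 2)) * a2) (cnj (m (x 3)) * a3) \<le> form3 A C B a1 a2 a3"
      using *[of "tri a1 a2 a3"] by (simp add: gram_form_eq)
  qed
next
  assume "contr3 A C B (m (x 1)) (m (x 2)) (m (x 3))"
  then show "mult_norm ip (points x) m \<le> 1"
    unfolding contractive_iff gram_form_eq contr3_def by blast
qed

text \<open>\<open>zero_first\<close> supplies the bound and, at equality, the remaining value;
  \<open>zero_first_extremal\<close> supplies contractivity. The other three one-point problems
  follow the same pattern.\<close>

lemma M_2: "M_at ip x 2 = tri 0 (of_real (sqrt S)) (u / of_real (sqrt S))"
  unfolding M_at_def
proof (rule extremal_mult_eqI(1))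
  fix m assume m: "m \<in> functions_on (points x)" "mult_norm ip (points x) m \<le> 1" "\<forall>z\<in>{x 1}. m z = 0"
  then have c: "contr3 A C B 0 (m (x 2)) (m (x 3))"
    by (simp add: mult_norm_le_1_iff)
  note z = zero_first[OF c]
  show "Re (m (x 2)) \<le> Re (tri 0 (of_real (sqrt S)) (u / of_real (sqrt S)) (x 2))"
    using Re_le_sqrt[OF z(1)] by simp
  assume "Re (m (x 2)) = Re (tri 0 (of_real (sqrt S)) (u / of_real (sqrt S)) (x 2))"
  then have "m (x 2) = of_real (sqrt S)"
    by (intro eq_of_Re_eq_sqrt[OF z(1)]) simp
  with z(2) m show "m = tri 0 (of_real (sqrt S)) (u / of_real (sqrt S))"
    by (intro tri_eqI) auto
qed (use S zero_first_extremal in \<open>auto simp: mult_norm_le_1_iff\<close>)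

lemma M_3: "M_at ip x 3 = tri 0 (cnj u / of_real (sqrt R)) (of_real (sqrt R))"
  unfolding M_at_def
proof (rule extremal_mult_eqI(1))
  let ?m = "tri 0 (cnj u / of_real (sqrt R)) (of_real (sqrt R))"
  fix m assume m: "m \<in> functions_on (points x)" "mult_norm ip (points x) m \<le> 1" "\<forall>z\<in>{x 1}. m z = 0"
  then have c: "contr3 A C B 0 (m (x 2)) (m (x 3))"
    by (simp add: mult_norm_le_1_iff)
  note z = zero_first_swapped[OF c]
  show "Re (m (x 3)) \<le> Re (?m (x 3))"
    using Re_le_sqrt[OF z(1)] by simp
  assume "Re (m (x 3)) = Re (?m (x 3))"
  then have "m (x 3) = of_real (sqrt R)"
    by (intro eq_of_Re_eq_sqrt[OF z(1)]) simp
  with z(2) m show "m = ?m"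
    by (intro tri_eqI) auto
qed (use R zero_first_extremal_swapped in \<open>auto simp: mult_norm_le_1_iff\<close>)

lemma m_2: "m_at ip x 2 = tri (of_real (sqrt S)) 0 ((of_real S - u) / (of_real (sqrt S) * (1 - u)))"
  unfolding m_at_def
proof (rule extremal_mult_eqI(1))
  let ?m = "tri (of_real (sqrt S)) 0 ((of_real S - u) / (of_real (sqrt S) * (1 - u)))"
  fix m assume m: "m \<in> functions_on (points x)" "mult_norm ip (points x) m \<le> 1" "\<forall>z\<in>{x 2}. m z = 0"
  then have c: "contr3 A C B (m (x 1)) 0 (m (x 3))"
    using mult_norm_le_1_iff[of m] by simp
  note z = zero_second[OF c]
  show "Re (m (x 1)) \<le> Re (?m (x 1))"
    using Re_le_sqrt[OF z(1)] by simp
  assume "Re (m (x 1)) = Re (?m (x 1))"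
  then have "m (x 1) = of_real (sqrt S)"
    by (intro eq_of_Re_eq_sqrt[OF z(1)]) simp
  with z(2) m show "m = ?m"
    by (intro tri_eqI) auto
qed (use S zero_second_extremal in \<open>auto simp: mult_norm_le_1_iff\<close>)

lemma m_3: "m_at ip x 3 = tri (of_real (sqrt R)) ((of_real R - cnj u) / (of_real (sqrt R) * (1 - cnj u))) 0"
  unfolding m_at_def
proof (rule extremal_mult_eqI(1))
  let ?m = "tri (of_real (sqrt R)) ((of_real R - cnj u) / (of_real (sqrt R) * (1 - cnj u))) 0"
  fix m assume m: "m \<in> functions_on (points x)" "mult_norm ip (points x) m \<le> 1" "\<forall>z\<in>{x 3}. m z = 0"
  then have c: "contr3 A C B (m (x 1)) (m (x 2)) 0"
    using mult_norm_le_1_iff[of m] by simp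
  note z = zero_third[OF c]
  show "Re (m (x 1)) \<le> Re (?m (x 1))"
    using Re_le_sqrt[OF z(1)] by simp
  assume "Re (m (x 1)) = Re (?m (x 1))"
  then have "m (x 1) = of_real (sqrt R)"
    by (intro eq_of_Re_eq_sqrt[OF z(1)]) simp
  with z(2) m show "m = ?m"
    by (intro tri_eqI) auto
qed (use R zero_third_extremal in \<open>auto simp: mult_norm_le_1_iff\<close>)

abbreviation "D \<equiv> schur A C B"

lemma m23_eq: "m23 ip x = tri (of_real (sqrt D)) 0 0"
  and norm_m23: "mult_norm ip (points x) (tri (of_real (sqrt D)) 0 0) = 1"
  and Re_le_D: "m \<in> functions_on (points x) \<Longrightarrow> mult_norm ip (points x) m \<le> 1 \<Longrightarrow>
                  m (x 2) = 0 \<Longrightarrow> m (x 3) = 0 \<Longrightarrow> Re (m (x 1)) \<le> sqrt D"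
proof -
  let ?m = "tri (of_real (sqrt D)) 0 0"
  have z: "(cmod (m (x 1)))\<^sup>2 \<le> D" if "mult_norm ip (points x) m \<le> 1" "m (x 2) = 0" "m (x 3) = 0" for m
    using that by (simp add: mult_norm_le_1_iff zero_both)
  then show le: "m \<in> functions_on (points x) \<Longrightarrow> mult_norm ip (points x) m \<le> 1 \<Longrightarrow>
                  m (x 2) = 0 \<Longrightarrow> m (x 3) = 0 \<Longrightarrow> Re (m (x 1)) \<le> sqrt D" for m
    by (intro Re_le_sqrt) blast
  have contr: "mult_norm ip (points x) ?m \<le> 1"
    using schur_pos by (simp add: mult_norm_le_1_iff zero_both)
  have unique: "m = ?m" if "m \<in> functions_on (points x)" "mult_norm ip (points x) m \<le> 1"
    "m (x 2) = 0" "m (x 3) = 0" "Re (m (x 1)) = sqrt D" for m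
    using that z[of m] by (intro tri_eqI eq_of_Re_eq_sqrt) auto
  have "extremal_mult ip (points x) {x 2, x 3} (x 1) = ?m"
    by (rule extremal_mult_eqI) (use contr schur_pos le unique in auto)
  then show "m23 ip x = ?m"
    by (simp only: m23_def)
  show "mult_norm ip (points x) ?m = 1"
    by (rule extremal_mult_eqI(2)[where Z = "{x 2, x 3}" and p = "x 1"])
      (use contr schur_pos le unique in auto)
qed

lemma Delta_eq: "Delta ip x = sqrt D"
  unfolding Delta_def
proof (rule cSup_eq_maximum)
  show "sqrt D \<in> {Re (m (x 1)) | m. m \<in> Mult (points x) \<and> m (x 2) = 0 \<and> m (x 3) = 0 \<and>
                    mult_norm ip (points x) m \<le> 1}"
    using norm_m23 by (intro CollectI exI[of _ "tri (of_real (sqrt D)) 0 0"]) (simp add: Mult_eq)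
qed (auto simp: Mult_eq Re_le_D)

section \<open>The conditions reduced to equality in Cauchy-Schwarz\<close>

lemma kk_eq: "i \<in> {1,2,3} \<Longrightarrow> j \<in> {1,2,3} \<Longrightarrow> kk ip x i j = da_kernel (x i) (x j)"
  unfolding kk_def by (intro reproducing kernel_mem) auto

lemma delta_eq: "delta ip x 1 2 = sqrt S" "delta ip x 1 3 = sqrt R"
proof -
  have "1 - 1 / C = R"
    by (simp add: C_def inverse_eq_divide)
  then show "delta ip x 1 2 = sqrt S" "delta ip x 1 3 = sqrt R"
    using Schur_complement_entries(1) by (simp_all add: delta_def kk_eq kernel_values)
qed

lemma LF_sq_eq: "LF_sq ip x = (cmod u)\<^sup>2 / S"
proof -
  have "1 / B = 1 - u"
    by (simp add: B_def divide_inverse)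
  then have "LF_sq ip x = 1 / (sqrt S)\<^sup>2 * (cmod (1 - (1 - u)))\<^sup>2"
    unfolding LF_sq_def delta_eq by (simp add: kk_eq kernel_values)
  then show ?thesis
    by simp
qed

lemma LF_iff: "LF_sq ip x = (delta ip x 1 3)\<^sup>2 \<longleftrightarrow> (cmod u)\<^sup>2 = S * R"
  unfolding LF_sq_eq delta_eq using S(1) R(1) by (simp add: divide_eq_eq mult.commute)

text \<open>The defect \<open>S * R - (cmod u)\<^sup>2\<close> equals \<open>S * t\<^sup>2\<close>,
  and \<open>S\<close> is positive.\<close>

lemma class_E_iff: "x \<in> class_E \<longleftrightarrow> (cmod u)\<^sup>2 = S * R"
proof -
  have "x \<in> class_E \<longleftrightarrow> t = 0"
  proof
    assume "x \<in> class_E"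
    then show "t = 0"
      using coords(6) by (auto simp: class_E_def dest: normal_triple_coordinates(6))
  qed (use nt in \<open>auto simp: class_E_def\<close>)
  also have "\<dots> \<longleftrightarrow> (cmod u)\<^sup>2 = S * R"
    using s_pos by (simp add: norm_mult power_mult_distrib algebra_simps)
  finally show ?thesis .
qed

lemma M_iff: "(\<exists>\<alpha>. cmod \<alpha> = 1 \<and> M_at ip x 2 = (\<lambda>z. \<alpha> * M_at ip x 3 z)) \<longleftrightarrow> (cmod u)\<^sup>2 = S * R"
proof
  assume "\<exists>\<alpha>. cmod \<alpha> = 1 \<and> M_at ip x 2 = (\<lambda>z. \<alpha> * M_at ip x 3 z)"
  then obtain \<alpha> where \<alpha>: "cmod \<alpha> = 1" "of_real (sqrt S) = \<alpha> * (cnj u / of_real (sqrt R))"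
    unfolding M_2 M_3 tri_scale tri_eq_iff by blast
  \<comment> \<open>The modulus of the value at \<open>x 2\<close> alone already forces the
    equality.\<close>
  have "sqrt S = cmod u / sqrt R"
    using arg_cong[OF \<alpha>(2), of cmod] \<alpha>(1) S(1) R(1) by (simp add: norm_mult norm_divide)
  then have "cmod u = sqrt S * sqrt R"
    using R(1) by (simp add: field_simps)
  then show "(cmod u)\<^sup>2 = S * R"
    using S(1) R(1) by (simp add: power_mult_distrib)
next
  assume eq: "(cmod u)\<^sup>2 = S * R"
  define \<sigma> where "\<sigma> = complex_of_real (sqrt S)"
  define \<rho> where "\<rho> = complex_of_real (sqrt R)"
  define v where "v = u"
  have nz: "\<sigma> \<noteq> 0" "\<rho> \<noteq> 0"
    using S(1) R(1) by (auto simp: \<sigma>_def \<rho>_def)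
  moreover have "v * cnj v = \<sigma> * \<sigma> * (\<rho> * \<rho>)"
  proof -
    have "\<sigma> * \<sigma> = of_real S" "\<rho> * \<rho> = of_real R"
      using S(1) R(1) by (simp_all only: \<sigma>_def \<rho>_def real_sqrt_mult_self abs_of_pos flip: of_real_mult)
    then show ?thesis
      unfolding v_def complex_norm_square[symmetric] eq by (simp only: of_real_mult)
  qed
  \<comment> \<open>The witness is \<alpha> = u divided by the square roots of \<open>S\<close> and
    \<open>R\<close>; these are its two equations at \<open>x 2\<close> and \<open>x 3\<close>. The
    names \<sigma>, \<rho>, v keep roots and products opaque.\<close>
  ultimately have "\<sigma> = v / (\<sigma> * \<rho>) * (cnj v / \<rho>)" "v / \<sigma> = v / (\<sigma> * \<rho>) * \<rho>"
    by (simp_all add: field_simps)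
  moreover have "cmod (v / (\<sigma> * \<rho>)) = 1"
  proof -
    have "cmod \<sigma> = sqrt S" "cmod \<rho> = sqrt R"
      using S(1) R(1) by (simp_all only: \<sigma>_def \<rho>_def norm_of_real abs_of_pos real_sqrt_gt_0_iff)
    moreover have "cmod v = sqrt (S * R)"
      using eq by (simp add: v_def real_sqrt_unique)
    ultimately have "cmod v = cmod \<sigma> * cmod \<rho>"
      by (simp only: real_sqrt_mult)
    then show ?thesis
      using nz by (simp add: norm_divide norm_mult)
  qed
  ultimately show "\<exists>\<alpha>. cmod \<alpha> = 1 \<and> M_at ip x 2 = (\<lambda>z. \<alpha> * M_at ip x 3 z)"
    unfolding M_2 M_3 tri_scale tri_eq_iff \<sigma>_def[symmetric] \<rho>_def[symmetric] v_def[symmetric]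
    by (intro exI[of _ "v / (\<sigma> * \<rho>)"]) simp
qed

lemma sqrt_D_iff: "sqrt D = sqrt S * sqrt R \<longleftrightarrow> (cmod u)\<^sup>2 = S * R"
  by (simp only: real_sqrt_mult[symmetric] real_sqrt_eq_iff schur_eq_iff)

lemma m_mult: "(\<lambda>z. m_at ip x 2 z * m_at ip x 3 z) = tri (of_real (sqrt S * sqrt R)) 0 0"
  unfolding m_2 m_3 tri_mult by simp

lemma m23_iff: "m23 ip x = (\<lambda>z. m_at ip x 2 z * m_at ip x 3 z) \<longleftrightarrow> (cmod u)\<^sup>2 = S * R"
  unfolding m_mult m23_eq tri_eq_iff sqrt_D_iff[symmetric] by (simp only: of_real_eq_iff simp_thms)

text \<open>The product is a positive multiple k of the extremal multiplier \<open>m23 ip x\<close>,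
  which has norm one; hence its norm is k.\<close>

lemma mult_norm_iff:
  "mult_norm ip (points x) (\<lambda>z. m_at ip x 2 z * m_at ip x 3 z) = 1 \<longleftrightarrow> (cmod u)\<^sup>2 = S * R"
proof -
  define k where "k = sqrt S * sqrt R / sqrt D"
  have k: "k > 0"
    using S(1) R(1) schur_pos by (simp add: k_def)
  have "sqrt S * sqrt R = k * sqrt D"
    using schur_pos by (simp add: k_def)
  then have "tri (of_real (sqrt S * sqrt R)) 0 0 = (\<lambda>z. of_real k * tri (of_real (sqrt D)) 0 0 z)"
    by (simp only: tri_scale of_real_mult mult_zero_right)
  then have "mult_norm ip (points x) (tri (of_real (sqrt S * sqrt R)) 0 0) = k"
    using mult_norm_scale[OF k] norm_m23 by simp
  moreover have "k = 1 \<longleftrightarrow> sqrt D = sqrt S * sqrt R"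
    using schur_pos by (auto simp: k_def divide_eq_eq)
  ultimately show ?thesis
    unfolding m_mult sqrt_D_iff[symmetric] by simp
qed

lemma Delta_iff: "Delta ip x = delta ip x 1 2 * delta ip x 1 3 \<longleftrightarrow> (cmod u)\<^sup>2 = S * R"
  unfolding Delta_eq delta_eq by (rule sqrt_D_iff)

end

theorem proposition28:
  fixes e :: "nat \<Rightarrow> 'n::finite"
    and y :: "nat \<Rightarrow> complex ^ 'n"
    and x :: "nat \<Rightarrow> complex ^ 2"
    and DA2 :: "(complex ^ 2 \<Rightarrow> complex) set"
    and ip :: "(complex ^ 2 \<Rightarrow> complex) \<Rightarrow> (complex ^ 2 \<Rightarrow> complex) \<Rightarrow> complex"
  assumes "bij_betw e {1..CARD('n)} UNIV"
    and "inj_on y {1, 2, 3}" and "points y \<subseteq> unit_ball"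
    and "normal_form e y x"
    and "drury_arveson_2 DA2 ip"
  shows "tfae
    [\<exists>G. complex_geodesic e G \<and> points y \<subseteq> G,
     x \<in> class_E,
     LF_sq ip x = (delta ip x 1 3)\<^sup>2,
     \<exists>\<alpha>. cmod \<alpha> = 1 \<and> M_at ip x 2 = (\<lambda>z. \<alpha> * M_at ip x 3 z),
     m23 ip x = (\<lambda>z. m_at ip x 2 z * m_at ip x 3 z),
     mult_norm ip (points x) (\<lambda>z. m_at ip x 2 z * m_at ip x 3 z) = 1,
     Delta ip x = delta ip x 1 2 * delta ip x 1 3]"
proof -
  obtain s w t where nt: "normal_triple s w t x"
    using assms(4) by (auto simp: normal_form_def)
  interpret normal_da DA2 ip x s w t
    using nt assms(5) by unfold_locales
  note iffs = complex_geodesic_iff_class_E[OF assms(1,3,4)] class_E_iff LF_iff M_iff m23_iff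
    mult_norm_iff Delta_iff
  show ?thesis
    unfolding tfae_def iffs by simp
qed

end
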